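(* For all $(\lambda^{(1)}|\cdots|\lambda^{(r)})\in\mathrm{Par}^r$, $$\mathcal{S}_{(\lambda^{(1)}|\cdots|\lambda^{(r)})}=m_{(\lambda^{(1)}|\cdots|\lambda^{(r)})}+\sum_{(\mu^{(1)}|\cdots|\mu^{(r)})\prec(\lambda^{(1)}|\cdots|\lambda^{(r)})}K^{(\lambda^{(1)}|\cdots|\lambda^{(r)})}_{(\mu^{(1)}|\cdots|\mu^{(r)})}\,m_{(\mu^{(1)}|\cdots|\mu^{(r)})}.$$
   Context: Key polynomials $\mathcal{K}_\alpha$: unique polynomials with $\mathcal{K}_\alpha=x^\alpha$ if $\alpha$ weakly decreasing and $\mathcal{K}_{s_i\alpha}=\xi_i\mathcal{K}_\alpha$ whenever $\alpha_i>\alpha_{i+1}$, $\xi_if=\frac{x_if-x_{i+1}s_if}{x_i-x_{i+1}}$. $\mathrm{rev}(\lambda)=(\lambda_{\ell(\lambda)},\dots,\lambda_1)$, $*$ concatenation, $0^m$ $m$ zeros. $\mathcal{S}_{(\lambda)}(X_1|\cdots|X_r)\in\Lambda(X_1)\otimes\cdots\otimes\Lambda(X_r)$ is the coefficientwise limit as $n_i\to\infty$ of $\mathcal{K}_\gamma(x_{1,1},\dots,x_{r,n_r})$, $\gamma=(0^{n_1-\ell(\lambda^{(1)})}*\mathrm{rev}(\lambda^{(1)}))*\cdots*(0^{n_r-\ell(\lambda^{(r)})}*\mathrm{rev}(\lambda^{(r)}))$. $m_{(\mu)}=m_{\mu^{(1)}}(X_1)\cdots m_{\mu^{(r)}}(X_r)$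 and $K^{(\lambda)}_{(\mu)}$ are the coefficients of $\mathcal{S}_{(\lambda)}$ in this basis. Lexicographic order on partitions (padded with zeros): $\mu<_L\lambda$ if for some $k$, $\mu_i=\lambda_i$ for $i<k$ and $\mu_k<\lambda_k$. On $\mathrm{Par}^r$: $(\mu)\prec(\lambda)$ if there is $1\le k\le r$ with $\mu^{(i)}=\lambda^{(i)}$ for all $i>k$ and $\mu^{(k)}<_L\lambda^{(k)}$. *)

theory Defs
  imports
    "HOL-Library.Poly_Mapping"
    "HOL-Library.Multiset"
    "HOL-Combinatorics.Transposition"
begin

section \<open>Key polynomials\<close>

text \<open>
  Exponent vectors are finitely supported maps into the naturals, polynomials are finitely
  supported maps from exponent vectors to integers. All indices (of variables, of entries of a
  list, of blocks) start at 0. In particular the paper's $x_i$ is variable number $i - 1$.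
\<close>

type_synonym 'v monomial = "'v \<Rightarrow>\<^sub>0 nat"
type_synonym 'v poly_in = "'v monomial \<Rightarrow>\<^sub>0 int"

definition Var :: "'v \<Rightarrow> 'v poly_in" where
  "Var v = Poly_Mapping.single (Poly_Mapping.single v 1) 1"

definition rename_monomial :: "('v \<Rightarrow> 'w) \<Rightarrow> 'v monomial \<Rightarrow> 'w monomial" where
  "rename_monomial \<phi> e =
     (\<Sum>v\<in>Poly_Mapping.keys e. Poly_Mapping.single (\<phi> v) (Poly_Mapping.lookup e v))"

text \<open>The substitution $x_v \mapsto x_{\varphi(v)}$.\<close>

definition rename :: "('v \<Rightarrow> 'w) \<Rightarrow> 'v poly_in \<Rightarrow> 'w poly_in" where
  "rename \<phi> f =
     (\<Sum>e\<in>Poly_Mapping.keys f.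
        Poly_Mapping.single (rename_monomial \<phi> e) (Poly_Mapping.lookup f e))"

text \<open>
  The operator $\xi_i$. There is no division of polynomials here, so the quotient is the
  unique polynomial whose product with the denominator is the numerator.
\<close>

definition xi :: "nat \<Rightarrow> nat poly_in \<Rightarrow> nat poly_in" where
  "xi i f =
     (THE g. (Var i - Var (Suc i)) * g = Var i * f - Var (Suc i) * rename (transpose i (Suc i)) f)"

definition swap_entries :: "nat \<Rightarrow> nat list \<Rightarrow> nat list" where
  "swap_entries i \<alpha> = \<alpha>[i := \<alpha> ! Suc i, Suc i := \<alpha> ! i]"

text \<open>
  Compositions are lists, and one family covers all numbers of variables at once, as
  the conditions only relate compositions of the same length. \<^const>\<open>Poly_Mapping.nth\<close> turns a list into the
  exponent vector with these entries.
\<close>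

definition is_key_family :: "(nat list \<Rightarrow> nat poly_in) \<Rightarrow> bool" where
  "is_key_family K \<longleftrightarrow>
     (\<forall>\<alpha>. sorted_wrt (\<ge>) \<alpha> \<longrightarrow> K \<alpha> = Poly_Mapping.single (Poly_Mapping.nth \<alpha>) 1) \<and>
     (\<forall>\<alpha> i. Suc i < length \<alpha> \<and> \<alpha> ! i > \<alpha> ! Suc i \<longrightarrow> K (swap_entries i \<alpha>) = xi i (K \<alpha>))"

definition key_poly :: "nat list \<Rightarrow> nat poly_in" where
  "key_poly = (THE K. is_key_family K)"


section \<open>Tuples of partitions\<close>

definition Par :: "nat list set" where
  "Par = {p. sorted_wrt (\<ge>) p \<and> 0 \<notin> set p}"

definition Par_tuples :: "nat \<Rightarrow> nat list list set" where
  "Par_tuples r = {las. length las = r \<and> set las \<subseteq> Par}"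

definition lex_less :: "nat list \<Rightarrow> nat list \<Rightarrow> bool" where
  "lex_less \<mu> la \<longleftrightarrow>
     (\<exists>k. (\<forall>i<k. nth_default 0 \<mu> i = nth_default 0 la i) \<and>
          nth_default 0 \<mu> k < nth_default 0 la k)"

definition tuple_less :: "nat \<Rightarrow> nat list list \<Rightarrow> nat list list \<Rightarrow> bool" where
  "tuple_less r \<mu>s las \<longleftrightarrow>
     (\<exists>k<r. (\<forall>i. k < i \<and> i < r \<longrightarrow> \<mu>s ! i = las ! i) \<and> lex_less (\<mu>s ! k) (las ! k))"


section \<open>Multisymmetric functions\<close>

text \<open>
  A formal series is the function of its coefficients. The variable $x_{i,j}$ of block $X_i$ is
  the pair of \<open>i\<close> and \<open>j\<close>, and $\Lambda(X_1) \otimes \cdots \otimes \Lambda(X_r)$ is viewed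
  inside the series in these variables.
\<close>

type_synonym 'v series = "'v monomial \<Rightarrow> int"

text \<open>
  $m_\lambda$ is the sum of all distinct monomials whose nonzero exponents are a rearrangement
  of the parts of $\lambda$.
\<close>

definition mono_sym :: "nat list \<Rightarrow> nat series" where
  "mono_sym la e =
     (if image_mset (Poly_Mapping.lookup e) (mset_set (Poly_Mapping.keys e)) = mset la
      then 1 else 0)"

text \<open>
  The product $m_{\mu^{(1)}}(X_1) \cdots m_{\mu^{(r)}}(X_r)$: the factors have disjoint sets of
  variables, so its coefficient at a monomial is the product of the coefficients of the factors
  at the parts of the monomial in the respective blocks.
\<close>

definition multi_mono_sym :: "nat list list \<Rightarrow> (nat \<times> nat) series" where
  "multi_mono_sym \<mu>s e =
     (if Poly_Mapping.keys e \<subseteq> {..<length \<mu>s} \<times> UNIV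
      then \<Prod>i<length \<mu>s. mono_sym (\<mu>s ! i) (Poly_Mapping.map_key (Pair i) e)
      else 0)"

text \<open>
  The coefficients of a series in the basis $m_{(\mu)}$, for $(\mu)$ in $\mathrm{Par}^r$. All but
  finitely many vanish.
\<close>

definition mono_expansion :: "nat \<Rightarrow> (nat \<times> nat) series \<Rightarrow> nat list list \<Rightarrow> int" where
  "mono_expansion r F =
     (THE c. finite {\<mu>s. c \<mu>s \<noteq> 0} \<and> {\<mu>s. c \<mu>s \<noteq> 0} \<subseteq> Par_tuples r \<and>
             F = (\<lambda>e. \<Sum>\<mu>s | c \<mu>s \<noteq> 0. c \<mu>s * multi_mono_sym \<mu>s e))"


section \<open>Stable limits of key polynomials\<close>

text \<open>
  \<open>ns\<close> lists the block sizes $n_1, \dots, n_r$. \<open>block_vars ns\<close> lists the variables in the order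
  $x_{1,1}, \dots, x_{1,n_1}, \dots, x_{r,1}, \dots, x_{r,n_r}$. The composition \<open>block_comp\<close> is
  only meaningful if every block size is at least the length of the respective partition.
\<close>

definition block_vars :: "nat list \<Rightarrow> (nat \<times> nat) list" where
  "block_vars ns = concat (map (\<lambda>i. map (Pair i) [0..<ns ! i]) [0..<length ns])"

definition block_comp :: "nat list list \<Rightarrow> nat list \<Rightarrow> nat list" where
  "block_comp las ns =
     concat (map2 (\<lambda>p n. replicate (n - length p) 0 @ rev p) las ns)"

definition block_key_poly :: "nat list list \<Rightarrow> nat list \<Rightarrow> (nat \<times> nat) poly_in" where
  "block_key_poly las ns = rename (\<lambda>k. block_vars ns ! k) (key_poly (block_comp las ns))"

text \<open>
  The limit is taken in the discrete ring of integers: a coefficient converges if it is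
  constant once all the block sizes are large enough.
\<close>

definition stable_key :: "nat list list \<Rightarrow> (nat \<times> nat) series" where
  "stable_key las e =
     (THE c. \<exists>N. \<forall>ns. length ns = length las \<and> (\<forall>n\<in>set ns. N \<le> n) \<longrightarrow>
                   Poly_Mapping.lookup (block_key_poly las ns) e = c)"

definition kostka_coeff :: "nat list list \<Rightarrow> nat list list \<Rightarrow> int" where
  "kostka_coeff las = mono_expansion (length las) (stable_key las)"

end

theory Submission
  imports Defs
begin

text \<open>
  The operators $\xi_i$ satisfy the braid relations, so sorting out the ascents of a composition
  $\gamma$ in any order gives the same polynomial $\mathcal{K}_\gamma$. Three properties of
  $\mathcal{K}_\gamma$ follow by induction along the ascents. It is symmetric in $x_i, x_{i+1}$
  if $\gamma_i \le \gamma_{i+1}$. Setting $x_k = 0$ where $\gamma_k = 0$ gives the key polynomial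
  of $\gamma$ without its $k$-th entry. Its degree in the last variable is the last entry of
  $\gamma$, with the key polynomial of the remaining entries as leading coefficient.

  By the first two properties, the coefficient of a monomial in the key polynomial of the blocks
  depends only on the partitions formed by the exponents in each block, and not on the block
  sizes once they are large enough. These coefficients are the $K^{(\lambda)}_{(\mu)}$. By the third, every
  exponent vector in $\mathcal{K}_\gamma$ other than $\gamma$, which occurs with coefficient 1,
  is smaller than $\gamma$ at the last place where they differ. As the blocks list the parts of
  the partitions in reverse, this order on exponent vectors is $\prec$.
\<close>


section \<open>Polynomials and substitutions\<close>

abbreviation coeff :: "'v poly_in \<Rightarrow> 'v monomial \<Rightarrow> int" where
  "coeff \<equiv> Poly_Mapping.lookup"

abbreviation mon :: "'v monomial \<Rightarrow> int \<Rightarrow> 'v poly_in" where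
  "mon \<equiv> Poly_Mapping.single"

text \<open>The added term need not have a new exponent, so claims additive in \<open>f\<close>
  reduce to single terms without tracking the support.\<close>

lemma poly_mapping_single_induct [case_names zero add]:
  fixes f :: "'a \<Rightarrow>\<^sub>0 'b::comm_monoid_add"
  assumes "P 0" "\<And>f e c. P f \<Longrightarrow> P (f + Poly_Mapping.single e c)"
  shows "P f"
proof (induction f rule: update_induct)
  case (update f a b)
  have "Poly_Mapping.update a b f = f + Poly_Mapping.single a b"
    using update(1)
    by (intro poly_mapping_eqI) (auto simp: lookup_update lookup_add lookup_single in_keys_iff)
  then show ?case using assms(2)[OF update(3)] by simp
qed (use assms(1) in auto)

text \<open>A sum over a fixed superset of the support is additive in \<open>e\<close>, while the
  index set in the definition changes with \<open>e\<close>.\<close>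

lemma rename_monomial_superset:
  assumes "finite S" "Poly_Mapping.keys e \<subseteq> S"
  shows "rename_monomial \<phi> e =
    (\<Sum>v\<in>S. Poly_Mapping.single (\<phi> v) (Poly_Mapping.lookup e v))"
  unfolding rename_monomial_def
  by (rule sum.mono_neutral_left) (use assms in \<open>auto simp: in_keys_iff\<close>)

lemma rename_monomial_zero [simp]: "rename_monomial \<phi> 0 = 0"
  by (simp add: rename_monomial_def)

lemma rename_monomial_add: "rename_monomial \<phi> (d + e) = rename_monomial \<phi> d + rename_monomial \<phi> e"
proof -
  let ?S = "Poly_Mapping.keys d \<union> Poly_Mapping.keys e"
  have "Poly_Mapping.keys (d + e) \<subseteq> ?S" by (rule keys_add)
  then show ?thesis
    by (simp add: rename_monomial_superset[of ?S] lookup_add single_add sum.distrib)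
qed

lemma rename_monomial_single [simp]:
  "rename_monomial \<phi> (Poly_Mapping.single v n) = Poly_Mapping.single (\<phi> v) n"
  by (subst rename_monomial_superset[of "{v}"]) auto

lemma rename_monomial_comp:
  "rename_monomial \<phi> (rename_monomial \<psi> e) = rename_monomial (\<phi> \<circ> \<psi>) e"
  by (induction e rule: poly_mapping_single_induct) (simp_all add: rename_monomial_add)

lemma rename_monomial_ident [simp]: "rename_monomial (\<lambda>v. v) e = e"
  by (induction e rule: poly_mapping_single_induct) (simp_all add: rename_monomial_add)

lemma rename_superset:
  assumes "finite S" "Poly_Mapping.keys f \<subseteq> S"
  shows "rename \<phi> f = (\<Sum>e\<in>S. mon (rename_monomial \<phi> e) (coeff f e))"
  unfolding rename_def
  by (rule sum.mono_neutral_left) (use assms in \<open>auto simp: in_keys_iff\<close>)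

lemma rename_zero [simp]: "rename \<phi> 0 = 0"
  by (simp add: rename_def)

lemma rename_add: "rename \<phi> (f + g) = rename \<phi> f + rename \<phi> g"
proof -
  let ?S = "Poly_Mapping.keys f \<union> Poly_Mapping.keys g"
  have "Poly_Mapping.keys (f + g) \<subseteq> ?S" by (rule keys_add)
  then show ?thesis
    by (simp add: rename_superset[of ?S] lookup_add single_add sum.distrib)
qed

lemma rename_single [simp]: "rename \<phi> (mon e c) = mon (rename_monomial \<phi> e) c"
  by (subst rename_superset[of "{e}"]) auto

lemma rename_diff: "rename \<phi> (f - g) = rename \<phi> f - rename \<phi> g"
  by (metis rename_add diff_add_cancel eq_diff_eq)

lemma rename_mult: "rename \<phi> (f * g) = rename \<phi> f * rename \<phi> g"
proof (induction f rule: poly_mapping_single_induct)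
  case (add f e c)
  have "rename \<phi> (mon e c * g) = rename \<phi> (mon e c) * rename \<phi> g"
    by (induction g rule: poly_mapping_single_induct)
      (simp_all add: distrib_left rename_add mult_single rename_monomial_add)
  with add show ?case by (simp add: distrib_right rename_add)
qed simp

lemma rename_comp: "rename \<phi> (rename \<psi> f) = rename (\<phi> \<circ> \<psi>) f"
  by (induction f rule: poly_mapping_single_induct) (simp_all add: rename_add rename_monomial_comp comp_def)

lemma rename_ident [simp]: "rename (\<lambda>v. v) f = f"
  by (induction f rule: poly_mapping_single_induct) (simp_all add: rename_add)

lemma rename_Var [simp]: "rename \<phi> (Var v) = Var (\<phi> v)"
  by (simp add: Var_def)

lemma coeff_rename:
  "coeff (rename \<phi> f) e = (\<Sum>d\<in>Poly_Mapping.keys f. (coeff f d when rename_monomial \<phi> d = e))"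
  by (simp add: rename_def lookup_sum lookup_single)

lemma coeff_rename_eq:
  assumes "\<And>e. e \<in> Poly_Mapping.keys f \<Longrightarrow> rename_monomial \<phi> e = rename_monomial \<phi> d \<Longrightarrow> e = d"
  shows "coeff (rename \<phi> f) (rename_monomial \<phi> d) = coeff f d"
proof -
  have "coeff (rename \<phi> f) (rename_monomial \<phi> d) =
      (\<Sum>e\<in>Poly_Mapping.keys f. if e = d then coeff f d else 0)"
    unfolding coeff_rename by (intro sum.cong) (use assms in \<open>auto simp: when_def\<close>)
  also have "\<dots> = coeff f d"
    by (auto simp: in_keys_iff)
  finally show ?thesis .
qed

lemma coeff_rename_zero:
  assumes "\<And>d. d \<in> Poly_Mapping.keys f \<Longrightarrow> rename_monomial \<phi> d \<noteq> e"
  shows "coeff (rename \<phi> f) e = 0"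
  unfolding coeff_rename using assms by (intro sum.neutral) auto

lemma coeff_single_mult_add:
  fixes g :: "'v poly_in"
  shows "coeff (mon t 1 * g) (t + e) = coeff g e"
  by (induction g rule: poly_mapping_single_induct)
    (simp_all add: distrib_left lookup_add mult_single lookup_single when_def)

lemma coeff_single_mult_zero:
  fixes g :: "'v poly_in"
  assumes "\<And>d. e \<noteq> t + d"
  shows "coeff (mon t 1 * g) e = 0"
  by (induction g rule: poly_mapping_single_induct)
    (use assms in \<open>auto simp: distrib_left lookup_add mult_single lookup_single when_def\<close>)


section \<open>The operators $\xi_i$\<close>

abbreviation swap_vars :: "nat \<Rightarrow> nat poly_in \<Rightarrow> nat poly_in" where
  "swap_vars i \<equiv> rename (transpose i (Suc i))"

lemma Var_eq_iff [simp]: "Var v = Var w \<longleftrightarrow> v = w"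
proof
  assume "Var v = Var w"
  then have "Poly_Mapping.keys (Var v) = Poly_Mapping.keys (Var w)" by simp
  then have "Poly_Mapping.single v (1::nat) = Poly_Mapping.single w 1" by (simp add: Var_def)
  then have "Poly_Mapping.keys (Poly_Mapping.single v (1::nat)) =
      Poly_Mapping.keys (Poly_Mapping.single w (1::nat))" by (rule arg_cong)
  then show "v = w" by simp
qed simp

lemma swap_vars_swap_vars [simp]: "swap_vars i (swap_vars i f) = f"
  by (simp add: rename_comp transpose_comp_involutory id_def)

text \<open>The polynomials \<open>f\<close> with this divisibility include the constants and the
  variables and are closed under sums and, by a twisted Leibniz rule, under products.\<close>

lemma diff_swap_vars_dvd:
  "(Var i - Var (Suc i)) dvd (f - swap_vars i f)" (is "?D dvd _")
proof -
  let ?s = "swap_vars i"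
  have mult: "?D dvd (f * g - ?s (f * g))" if "?D dvd (f - ?s f)" "?D dvd (g - ?s g)" for f g
  proof -
    have "f * g - ?s (f * g) = f * (g - ?s g) + (f - ?s f) * ?s g"
      by (simp add: rename_mult algebra_simps)
    then show ?thesis using that by simp
  qed
  have var: "?D dvd (Var v - ?s (Var v))" for v
  proof -
    have "?D dvd (Var (Suc i) - Var i)" by (metis dvd_minus_iff minus_diff_eq dvd_refl)
    then show ?thesis by (auto simp: transpose_def)
  qed
  have const: "?D dvd (mon 0 c - ?s (mon 0 c))" for c
    by (simp only: rename_single rename_monomial_zero diff_self dvd_0_right)
  have single: "?D dvd (mon (Poly_Mapping.single v n) 1 - ?s (mon (Poly_Mapping.single v n) 1))" for v n
  proof (induction n)
    case (Suc n)
    have "mon (Poly_Mapping.single v (Suc n)) 1 = Var v * mon (Poly_Mapping.single v n) 1"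
      by (simp add: Var_def mult_single flip: single_add)
    then show ?case using mult[OF var Suc] by simp
  qed (use const[of 1] in simp)
  have mono: "?D dvd (mon e c - ?s (mon e c))" for e c
  proof (induction e rule: poly_mapping_single_induct)
    case (add e v n)
    have "mon (e + Poly_Mapping.single v n) c = mon e c * mon (Poly_Mapping.single v n) 1"
      by (simp add: mult_single)
    then show ?case using mult[OF add single] by simp
  qed simp
  show ?thesis
  proof (induction f rule: poly_mapping_single_induct)
    case (add f e c)
    have "f + mon e c - ?s (f + mon e c) = (f - ?s f) + (mon e c - ?s (mon e c))"
      by (simp add: rename_add)
    then show ?case using add mono[of e c] by (metis dvd_add)
  qed simp
qed

text \<open>The quotient exists by divisibility and is unique since polynomials form an integral
  domain. From here on \<open>xi\<close> is used only through this equation.\<close>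

lemma xi_mult: "(Var i - Var (Suc i)) * xi i f = Var i * f - Var (Suc i) * swap_vars i f"
proof -
  have "Var i * f - Var (Suc i) * swap_vars i f =
      (Var i - Var (Suc i)) * f + Var (Suc i) * (f - swap_vars i f)"
    by (simp add: algebra_simps)
  then have "(Var i - Var (Suc i)) dvd (Var i * f - Var (Suc i) * swap_vars i f)"
    using diff_swap_vars_dvd[of i f] by simp
  then obtain g where g: "Var i * f - Var (Suc i) * swap_vars i f = (Var i - Var (Suc i)) * g"
    by (rule dvdE)
  have "\<exists>!g. (Var i - Var (Suc i)) * g = Var i * f - Var (Suc i) * swap_vars i f"
    by (rule ex1I[of _ g]) (use g in auto)
  from theI'[OF this] show ?thesis by (simp add: xi_def)
qed

lemma xi_unique:
  assumes "(Var i - Var (Suc i)) * g = Var i * f - Var (Suc i) * swap_vars i f"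
  shows "xi i f = g"
proof -
  have "(Var i - Var (Suc i)) * xi i f = (Var i - Var (Suc i)) * g"
    using assms xi_mult by simp
  then show ?thesis by simp
qed

lemma xi_eq_self: "swap_vars i f = f \<Longrightarrow> xi i f = f"
  by (rule xi_unique) (simp add: algebra_simps)

text \<open>The transposition negates both numerator and denominator, so it fixes the
  quotient.\<close>

lemma swap_vars_xi [simp]: "swap_vars i (xi i f) = xi i f"
proof -
  have "swap_vars i ((Var i - Var (Suc i)) * xi i f) =
      swap_vars i (Var i * f - Var (Suc i) * swap_vars i f)"
    by (simp only: xi_mult)
  then have "(Var (Suc i) - Var i) * swap_vars i (xi i f) = Var (Suc i) * swap_vars i f - Var i * f"
    by (simp add: rename_mult rename_diff)
  also have "\<dots> = (Var (Suc i) - Var i) * xi i f"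
    using xi_mult[of i f] by (simp add: algebra_simps)
  finally show ?thesis by simp
qed

lemma xi_idem [simp]: "xi i (xi i f) = xi i f"
  by (simp add: xi_eq_self)

section \<open>Commutation and braid relations\<close>

lemma xi_commute:
  assumes "Suc i < j"
  shows "xi i (xi j f) = xi j (xi i f)"
proof -
  define s t where "s = swap_vars i" and "t = swap_vars j"
  define x y z w :: "nat poly_in"
    where "x = Var i" and "y = Var (Suc i)" and "z = Var j" and "w = Var (Suc j)"
  note defs = s_def t_def x_def y_def z_def w_def
  have st: "s (t f) = t (s f)"
    unfolding defs rename_comp
    by (rule arg_cong[of _ _ "\<lambda>\<phi>. rename \<phi> f"]) (use assms in \<open>auto simp: fun_eq_iff transpose_def\<close>)
  have vars: "s z = z" "s w = w" "t x = x" "t y = y"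
    using assms by (simp_all add: defs transpose_def)
  have ne: "x - y \<noteq> 0" "z - w \<noteq> 0" by (simp_all add: defs)
  note hom = rename_mult[of "transpose i (Suc i)", folded s_def]
    rename_diff[of "transpose i (Suc i)", folded s_def]
    rename_mult[of "transpose j (Suc j)", folded t_def]
    rename_diff[of "transpose j (Suc j)", folded t_def] vars
  note m = xi_mult[of i, folded x_def y_def s_def] xi_mult[of j, folded z_def w_def t_def]
  have a: "(z - w) * s (xi j f) = z * s f - w * s (t f)"
    using arg_cong[OF m(2)[of f], of s] by (simp add: hom)
  have b: "(x - y) * t (xi i f) = x * t f - y * t (s f)"
    using arg_cong[OF m(1)[of f], of t] by (simp add: hom)
  \<comment> \<open>Clearing both denominators leaves the same combination of \<open>f\<close>,
    \<open>s f\<close>, \<open>t f\<close> and \<open>s (t f)\<close> on both sides, because the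
    transpositions commute and each fixes the variables of the other.\<close>
  have "(z - w) * ((x - y) * xi i (xi j f)) = x * ((z - w) * xi j f) - y * ((z - w) * s (xi j f))"
    unfolding m(1)[of "xi j f"] by (simp add: algebra_simps)
  also have "\<dots> = x * (z * f - w * t f) - y * (z * s f - w * s (t f))"
    by (simp only: a m(2))
  also have "\<dots> = z * (x * f - y * s f) - w * (x * t f - y * t (s f))"
    by (simp add: st algebra_simps)
  also have "\<dots> = z * ((x - y) * xi i f) - w * ((x - y) * t (xi i f))"
    by (simp only: b m(1))
  also have "\<dots> = (x - y) * ((z - w) * xi j (xi i f))"
    unfolding m(2)[of "xi i f"] by (simp add: algebra_simps)
  finally show ?thesis using ne by (simp add: mult.left_commute)
qed

text \<open>
  Multiplied by the Vandermonde product, both sides become the alternating sum of the images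
  of $x^2 y f$ under the permutations of the three variables.
\<close>

lemma xi_braid: "xi i (xi (Suc i) (xi i f)) = xi (Suc i) (xi i (xi (Suc i) f))"
proof -
  define s t where "s = swap_vars i" and "t = swap_vars (Suc i)"
  define x y z :: "nat poly_in"
    where "x = Var i" and "y = Var (Suc i)" and "z = Var (Suc (Suc i))"
  note defs = s_def t_def x_def y_def z_def
  have sts: "s (t (s f)) = t (s (t f))"
    unfolding defs rename_comp
    by (rule arg_cong[of _ _ "\<lambda>\<phi>. rename \<phi> f"]) (auto simp: fun_eq_iff transpose_def)
  have vars: "s x = y" "s y = x" "s z = z" "t x = x" "t y = z" "t z = y"
    by (simp_all add: defs transpose_def)
  have ne: "x - y \<noteq> 0" "y - z \<noteq> 0" "x - z \<noteq> 0" by (simp_all add: defs)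
  note hom = rename_mult[of "transpose i (Suc i)", folded s_def]
    rename_diff[of "transpose i (Suc i)", folded s_def]
    rename_mult[of "transpose (Suc i) (Suc (Suc i))", folded t_def]
    rename_diff[of "transpose (Suc i) (Suc (Suc i))", folded t_def] vars
  note m = xi_mult[of i, folded x_def y_def s_def] xi_mult[of "Suc i", folded y_def z_def t_def]
  note inv = swap_vars_xi[of i, folded s_def] swap_vars_xi[of "Suc i", folded t_def]
  define g where "g = xi i f"
  define h where "h = xi (Suc i) g"
  define g' where "g' = xi (Suc i) f"
  define h' where "h' = xi i g'"
  have g: "(x - y) * g = x * f - y * s f" "(x - z) * t g = x * t f - z * t (s f)"
      "(y - z) * s (t g) = y * s (t f) - z * s (t (s f))" "s g = g"
    subgoal by (simp add: g_def m)
    subgoal using arg_cong[OF m(1)[of f], of t] by (simp add: hom g_def)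
    subgoal using arg_cong[OF m(1)[of f], of "\<lambda>p. s (t p)"] by (simp add: hom g_def)
    subgoal by (simp add: g_def inv)
    done
  have h: "(y - z) * h = y * g - z * t g" "(x - z) * s h = x * g - z * s (t g)"
    subgoal by (simp add: h_def m)
    subgoal using arg_cong[OF m(2)[of g], of s] by (simp add: hom h_def g)
    done
  have g': "(y - z) * g' = y * f - z * t f" "(x - z) * s g' = x * s f - z * s (t f)"
      "(x - y) * t (s g') = x * t (s f) - y * t (s (t f))" "t g' = g'"
    subgoal by (simp add: g'_def m)
    subgoal using arg_cong[OF m(2)[of f], of s] by (simp add: hom g'_def)
    subgoal using arg_cong[OF m(2)[of f], of "\<lambda>p. t (s p)"] by (simp add: hom g'_def)
    subgoal by (simp add: g'_def inv)
    done
  have h': "(x - y) * h' = x * g' - y * s g'" "(x - z) * t h' = x * g' - z * t (s g')"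
    subgoal by (simp add: h'_def m)
    subgoal using arg_cong[OF m(1)[of g'], of t] by (simp add: hom h'_def g')
    done
  have "(x - z) * (y - z) * ((x - y) * xi i h) = x * (x - z) * ((y - z) * h) - y * (y - z) * ((x - z) * s h)"
    unfolding m(1)[of h] by (simp add: algebra_simps)
  also have "\<dots> = x * y * ((x - y) * g) - x * z * ((x - z) * t g) + y * z * ((y - z) * s (t g))"
    unfolding h by (simp add: algebra_simps)
  \<comment> \<open>Both sides expand to six terms in the images of \<open>f\<close>;
    \<open>sts\<close> identifies the two words for the longest permutation.\<close>
  also have "\<dots> = x * x * ((y - z) * g') - y * y * ((x - z) * s g') + z * z * ((x - y) * t (s g'))"
    unfolding g g' by (simp add: sts algebra_simps)
  also have "\<dots> = y * (x - z) * ((x - y) * h') - z * (x - y) * ((x - z) * t h')"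
    unfolding h' by (simp add: algebra_simps)
  also have "\<dots> = (x - y) * (x - z) * ((y - z) * xi (Suc i) h')"
    unfolding m(2)[of h'] by (simp add: algebra_simps)
  finally have "(x - y) * (x - z) * (y - z) * xi i h = (x - y) * (x - z) * (y - z) * xi (Suc i) h'"
    by (simp only: mult_ac)
  then show ?thesis using ne by (simp add: g_def h_def g'_def h'_def)
qed


section \<open>Coefficients indexed by lists\<close>

text \<open>Trailing zeros do not change the exponent vector of a list. Writing a position as
  \<open>length A\<close> in \<open>A @ p # B\<close> turns index arithmetic into rewriting of
  lists.\<close>

abbreviation list_coeff :: "nat poly_in \<Rightarrow> nat list \<Rightarrow> int" where
  "list_coeff f a \<equiv> coeff f (Poly_Mapping.nth a)"

lemma nth_default_middle:
  "nth_default d (A @ p # B) v =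
     (if v < length A then A ! v else if v = length A then p else nth_default d B (v - Suc (length A)))"
  by (auto simp: nth_default_append nth_default_Cons nth_default_nth split: nat.split
    dest!: arg_cong[of _ "Suc _" "\<lambda>n. n - 1"])

lemma nth_middle_Suc:
  "Poly_Mapping.nth (A @ Suc p # B) = Poly_Mapping.single (length A) 1 + Poly_Mapping.nth (A @ p # B)"
  by (rule poly_mapping_eqI) (auto simp: nth_default_middle lookup_add lookup_single when_def)

lemma list_coeff_Var_mult_Suc [simp]:
  "list_coeff (Var (length A) * g) (A @ Suc p # B) = list_coeff g (A @ p # B)"
  unfolding nth_middle_Suc Var_def by (rule coeff_single_mult_add)

lemma list_coeff_Var_mult_zero [simp]:
  "list_coeff (Var (length A) * g) (A @ 0 # B) = 0"
  unfolding Var_def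
proof (rule coeff_single_mult_zero, rule notI)
  fix d assume "Poly_Mapping.nth (A @ 0 # B) = Poly_Mapping.single (length A) 1 + d"
  then have "Poly_Mapping.lookup (Poly_Mapping.nth (A @ 0 # B)) (length A) =
      Poly_Mapping.lookup (Poly_Mapping.single (length A) 1 + d) (length A)" by simp
  then show False by (simp add: lookup_add nth_default_middle)
qed

lemma lookup_rename_monomial_inj:
  "inj \<phi> \<Longrightarrow> Poly_Mapping.lookup (rename_monomial \<phi> e) (\<phi> v) = Poly_Mapping.lookup e v"
  by (induction e rule: poly_mapping_single_induct)
    (auto simp: rename_monomial_add lookup_add lookup_single when_def inj_eq)

lemma rename_monomial_transpose_nth:
  "rename_monomial (transpose (length A) (Suc (length A))) (Poly_Mapping.nth (A @ p # q # B)) =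
     Poly_Mapping.nth (A @ q # p # B)"
proof (rule poly_mapping_eqI)
  fix v
  let ?t = "transpose (length A) (Suc (length A))"
  have "Poly_Mapping.lookup (rename_monomial ?t (Poly_Mapping.nth (A @ p # q # B))) (?t (?t v)) =
      Poly_Mapping.lookup (Poly_Mapping.nth (A @ p # q # B)) (?t v)"
    by (rule lookup_rename_monomial_inj) simp
  also have "\<dots> = Poly_Mapping.lookup (Poly_Mapping.nth (A @ q # p # B)) v"
    by (auto simp: nth_default_middle transpose_def nth_default_Cons split: nat.split)
  finally show "Poly_Mapping.lookup (rename_monomial ?t (Poly_Mapping.nth (A @ p # q # B))) v =
      Poly_Mapping.lookup (Poly_Mapping.nth (A @ q # p # B)) v"
    by simp
qed

lemma list_coeff_swap_vars:
  "list_coeff (swap_vars (length A) f) (A @ p # q # B) = list_coeff f (A @ q # p # B)"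
proof -
  let ?t = "transpose (length A) (Suc (length A))"
  have "list_coeff (swap_vars (length A) f) (A @ p # q # B) =
      coeff (rename ?t f) (rename_monomial ?t (Poly_Mapping.nth (A @ q # p # B)))"
    by (simp add: rename_monomial_transpose_nth)
  also have "\<dots> = list_coeff f (A @ q # p # B)"
  proof (rule coeff_rename_eq)
    fix e assume "rename_monomial ?t e = rename_monomial ?t (Poly_Mapping.nth (A @ q # p # B))"
    then have "rename_monomial ?t (rename_monomial ?t e) =
        rename_monomial ?t (rename_monomial ?t (Poly_Mapping.nth (A @ q # p # B)))" by simp
    then show "e = Poly_Mapping.nth (A @ q # p # B)"
      by (simp add: rename_monomial_comp transpose_comp_involutory id_def)
  qed
  finally show ?thesis .
qed

text \<open>Coefficients in \<open>xi_mult\<close> are compared at a vector with the second exponent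
  raised by one, so that multiplication by the second variable can be undone. Multiplication by the
  first contributes nothing where its exponent is 0.\<close>

lemma list_coeff_xi_rec:
  fixes f A B
  defines "F \<equiv> \<lambda>p q. list_coeff f (A @ p # q # B)"
  defines "G \<equiv> \<lambda>p q. list_coeff (xi (length A) f) (A @ p # q # B)"
  shows "G 0 q = F q 0" "G (Suc p) q = G p (Suc q) - F p (Suc q) + F q (Suc p)"
proof -
  let ?i = "length A"
  have snoc: "list_coeff (Var (Suc ?i) * g) (A @ p # Suc q # B) = list_coeff g (A @ p # q # B)" for g p q
    using list_coeff_Var_mult_Suc[of "A @ [p]" g q B] by simp
  have eq: "list_coeff (Var ?i * xi ?i f) a - list_coeff (Var (Suc ?i) * xi ?i f) a =
      list_coeff (Var ?i * f) a - list_coeff (Var (Suc ?i) * swap_vars ?i f) a" for a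
    using arg_cong[OF xi_mult[of ?i f], of "\<lambda>g. list_coeff g a"]
    by (simp add: lookup_minus algebra_simps)
  show "G 0 q = F q 0"
    using eq[of "A @ 0 # Suc q # B"] by (simp add: snoc list_coeff_swap_vars F_def G_def)
  show "G (Suc p) q = G p (Suc q) - F p (Suc q) + F q (Suc p)"
    using eq[of "A @ Suc p # Suc q # B"] by (simp add: snoc list_coeff_swap_vars F_def G_def)
qed

text \<open>
  $\xi_i$ sends $x_i^u x_{i+1}^v$ to the sum of the monomials between $x_i^u x_{i+1}^v$ and
  $x_i^v x_{i+1}^u$ if $u \ge v$, and to minus the sum of those strictly between them otherwise.
\<close>

lemma list_coeff_xi:
  "list_coeff (xi (length A) f) (A @ p # q # B) =
     (\<Sum>u = max p q..p + q. list_coeff f (A @ u # (p + q - u) # B)) -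
     (\<Sum>u = Suc (max p q)..p + q. list_coeff f (A @ (p + q - u) # u # B))"
proof (induction p arbitrary: q)
  case 0
  show ?case using list_coeff_xi_rec(1)[of A f q B] by simp
next
  case (Suc p)
  define F where "F = (\<lambda>p q. list_coeff f (A @ p # q # B))"
  define P where "P = (\<lambda>m. \<Sum>u = m..Suc (p + q). F u (Suc (p + q) - u))"
  define Q where "Q = (\<lambda>m. \<Sum>u = m..Suc (p + q). F (Suc (p + q) - u) u)"
  have P: "P m = F m (Suc (p + q) - m) + P (Suc m)" and Q: "Q m = F (Suc (p + q) - m) m + Q (Suc m)"
    if "m \<le> Suc (p + q)" for m
    using that by (auto simp: P_def Q_def sum.atLeast_Suc_atMost le_Suc_eq simp del: sum.cl_ivl_Suc)
  have "list_coeff (xi (length A) f) (A @ Suc p # q # B) =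
      P (max p (Suc q)) - Q (Suc (max p (Suc q))) - F p (Suc q) + F q (Suc p)"
    using list_coeff_xi_rec(2)[of A f p q B] Suc[of "Suc q"] by (simp add: P_def Q_def F_def)
  \<comment> \<open>Passing from \<open>(p, Suc q)\<close> to \<open>(Suc p, q)\<close> shifts both
    lower ends up by one, down by one or not at all. The terms lost or gained are exactly the two
    extra values of \<open>F\<close>, which cancel each other if \<open>q = p\<close>.\<close>
  also have "\<dots> = P (max (Suc p) q) - Q (Suc (max (Suc p) q))"
  proof -
    consider "q < p" | "q = p" | "p < q" by linarith
    then show ?thesis
    proof cases
      case 1
      then have "max p (Suc q) = p" "max (Suc p) q = Suc p" by simp_all
      then show ?thesis using P[of p] Q[of "Suc p"] 1 by (simp add: Suc_diff_le)
    next
      case 2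
      then show ?thesis by (simp add: max_def)
    next
      case 3
      then show ?thesis using P[of q] Q[of "Suc q"] by (simp add: max_def Suc_diff_le)
    qed
  qed
  finally show ?case by (simp add: P_def Q_def F_def)
qed


section \<open>Existence and uniqueness of key polynomials\<close>

text \<open>The entry at index \<open>i\<close> is counted \<open>i\<close> times, once per earlier
  position. Exchanging an ascent \<open>a < b\<close> lowers the total by \<open>b - a\<close>,
  which makes it the termination measure for sorting.\<close>

fun weight :: "nat list \<Rightarrow> nat" where
  "weight [] = 0"
| "weight (x # xs) = sum_list xs + weight xs"

lemma weight_append: "weight (A @ B) = weight A + length A * sum_list B + weight B"
  by (induction A) (auto simp: algebra_simps)

lemma weight_swap_less: "a < b \<Longrightarrow> weight (A @ b # a # B) < weight (A @ a # b # B)"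
  by (simp add: weight_append add.left_commute)

lemma not_sorted_ascent:
  fixes \<alpha> :: "nat list"
  assumes "\<not> sorted_wrt (\<ge>) \<alpha>"
  obtains A a b B where "\<alpha> = A @ a # b # B" "a < b"
proof -
  have "\<not> sorted_wrt (\<ge>) \<alpha> \<Longrightarrow> \<exists>A a b B. \<alpha> = A @ a # b # B \<and> a < b"
  proof (induction \<alpha>)
    case (Cons x xs)
    show ?case
    proof (cases "sorted_wrt (\<ge>) xs")
      case True
      then obtain y ys where "xs = y # ys" using Cons.prems by (cases xs) auto
      moreover from this have "x < y" using True Cons.prems by fastforce
      ultimately show ?thesis by (intro exI[of _ "[]"]) auto
    next
      case False
      then obtain A a b B where "xs = A @ a # b # B" "a < b" using Cons.IH by auto
      then show ?thesis by (intro exI[of _ "x # A"]) auto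
    qed
  qed simp
  then show ?thesis using assms that by blast
qed

lemma sorted_no_ascent: "sorted_wrt (\<ge>) (A @ a # b # B) \<Longrightarrow> b \<le> (a :: nat)"
  by (simp add: sorted_wrt_append)

lemma swap_entries_middle [simp]: "swap_entries (length A) (A @ a # b # B) = A @ b # a # B"
  by (simp add: swap_entries_def list_update_append nth_append)

lemma split_at_adjacent:
  fixes \<alpha> :: "nat list"
  assumes "Suc i < length \<alpha>"
  obtains A a b B where "\<alpha> = A @ a # b # B" "length A = i" "\<alpha> ! i = a" "\<alpha> ! Suc i = b"
proof -
  have "\<alpha> = take i \<alpha> @ \<alpha> ! i # \<alpha> ! Suc i # drop (Suc (Suc i)) \<alpha>"
    using assms by (metis Cons_nth_drop_Suc Suc_lessD append_take_drop_id)
  moreover have "length (take i \<alpha>) = i" using assms by simp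
  ultimately show ?thesis using that by blast
qed

text \<open>With indices replaced by splittings and read from the side of the ascent, the second
  condition becomes a rule that removes an ascent and lowers \<open>weight\<close>.\<close>

lemma is_key_family_iff:
  "is_key_family K \<longleftrightarrow>
     (\<forall>\<alpha>. sorted_wrt (\<ge>) \<alpha> \<longrightarrow> K \<alpha> = mon (Poly_Mapping.nth \<alpha>) 1) \<and>
     (\<forall>A a b B. a < b \<longrightarrow> K (A @ a # b # B) = xi (length A) (K (A @ b # a # B)))"
  (is "_ \<longleftrightarrow> ?base \<and> ?step")
proof -
  have "?step \<longleftrightarrow>
      (\<forall>\<alpha> i. Suc i < length \<alpha> \<and> \<alpha> ! i > \<alpha> ! Suc i \<longrightarrow> K (swap_entries i \<alpha>) = xi i (K \<alpha>))"
    (is "_ \<longleftrightarrow> ?step'")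
  proof
    assume ?step
    show ?step'
    proof (intro allI impI, elim conjE)
      fix \<alpha> :: "nat list" and i assume "Suc i < length \<alpha>" and gt: "\<alpha> ! i > \<alpha> ! Suc i"
      from this(1) obtain A a b B where \<alpha>: "\<alpha> = A @ a # b # B" "length A = i" "\<alpha> ! i = a" "\<alpha> ! Suc i = b"
        by (rule split_at_adjacent)
      then have "b < a" using gt by simp
      then show "K (swap_entries i \<alpha>) = xi i (K \<alpha>)" using \<open>?step\<close> \<alpha>(1,2) by auto
    qed
  next
    assume ?step'
    show ?step
    proof (intro allI impI)
      fix A a b B assume "a < (b :: nat)"
      then show "K (A @ a # b # B) = xi (length A) (K (A @ b # a # B))"
        using \<open>?step'\<close>[rule_format, of "length A" "A @ b # a # B"] by (simp add: nth_append)
    qed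
  qed
  then show ?thesis by (simp add: is_key_family_def)
qed

text \<open>Relates \<open>\<alpha>\<close> to every polynomial obtained by removing ascents in some
  order. It is a relation because independence of the order is still to be shown.\<close>

inductive key_rel :: "nat list \<Rightarrow> nat poly_in \<Rightarrow> bool" where
  base: "sorted_wrt (\<ge>) \<alpha> \<Longrightarrow> key_rel \<alpha> (mon (Poly_Mapping.nth \<alpha>) 1)"
| step: "key_rel (A @ b # a # B) f \<Longrightarrow> a < b \<Longrightarrow> key_rel (A @ a # b # B) (xi (length A) f)"

section \<open>Existence, and independence of the order of sorting\<close>

lemma key_rel_total: "\<exists>f. key_rel \<alpha> f"
proof (induction "weight \<alpha>" arbitrary: \<alpha> rule: less_induct)
  case less
  show ?case
  proof (cases "sorted_wrt (\<ge>) \<alpha>")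
    case True
    then show ?thesis by (blast intro: key_rel.base)
  next
    case False
    then obtain A a b B where \<alpha>: "\<alpha> = A @ a # b # B" "a < b" by (rule not_sorted_ascent)
    obtain f where "key_rel (A @ b # a # B) f"
      using less[of "A @ b # a # B"] weight_swap_less[OF \<alpha>(2)] \<alpha>(1) by blast
    then show ?thesis using key_rel.step \<alpha> by blast
  qed
qed

text \<open>Adjacent pairs at different places are disjoint or share one entry: the cases for the
  commutation and the braid relation.\<close>

lemma adjacent_pairs_cases:
  fixes \<alpha> :: "nat list"
  assumes "\<alpha> = A @ a # b # B" "\<alpha> = A' @ a' # b' # B'" "length A < length A'"
  obtains (far) C where "A' = A @ a # b # C" "B = C @ a' # b' # B'"
    | (near) "A' = A @ [a]" "a' = b" "B = b' # B'"
proof -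
  from assms have eq: "A @ (a # b # B) = A' @ (a' # b' # B')" by simp
  from assms(3) obtain D where D: "A' = A @ D" "a # b # B = D @ a' # b' # B'" "D \<noteq> []"
    using eq by (auto simp: append_eq_append_conv2)
  then obtain D' where D': "D = a # D'" by (cases D) auto
  show ?thesis
  proof (cases D')
    case Nil
    then show ?thesis using D D' near by auto
  next
    case (Cons d E)
    then show ?thesis using D D' far[of E] by auto
  qed
qed

text \<open>Confluence by induction on \<open>weight\<close>: two different first steps are joined
  at a common, further sorted composition, and the induction hypothesis identifies \<open>f'\<close>
  and \<open>g'\<close> with the polynomials obtained through it.\<close>

lemma key_rel_unique: "key_rel \<alpha> f \<Longrightarrow> key_rel \<alpha> g \<Longrightarrow> f = g"
proof (induction "weight \<alpha>" arbitrary: \<alpha> f g rule: less_induct)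
  case less
  have main: "xi (length A) f' = xi (length A') g'"
    if *: "\<alpha> = A @ a # b # B" "\<alpha> = A' @ a' # b' # B'" "a < b" "a' < b'" "length A < length A'"
      and f': "key_rel (A @ b # a # B) f'" and g': "key_rel (A' @ b' # a' # B') g'"
    for A a b B A' a' b' B' f' g'
  proof -
    have wf: "weight (A @ b # a # B) < weight \<alpha>" and wg: "weight (A' @ b' # a' # B') < weight \<alpha>"
      using weight_swap_less[OF *(3), of A B] weight_swap_less[OF *(4), of A' B'] *(1,2) by simp_all
    from *(1,2,5) show ?thesis
    proof (cases rule: adjacent_pairs_cases)
      case (far C)
      \<comment> \<open>\<open>h\<close> belongs to the composition with both ascents
        exchanged.\<close>
      obtain h where "key_rel (A @ b # a # C @ b' # a' # B') h" using key_rel_total by blast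
      then have "key_rel ((A @ b # a # C) @ b' # a' # B') h" "key_rel (A @ b # a # (C @ b' # a' # B')) h"
        by simp_all
      from this[THEN key_rel.step]
      have "key_rel (A @ b # a # B) (xi (length A') h)" "key_rel (A' @ b' # a' # B') (xi (length A) h)"
        using * far by simp_all
      then have "f' = xi (length A') h" "g' = xi (length A) h"
        using less(1) wf wg f' g' by blast+
      then show ?thesis using far xi_commute[of "length A" "length A'" h] by simp
    next
      case near
      then have ab: "a < b" "b < b'" "a < b'" using * by simp_all
      \<comment> \<open>The entries \<open>a < b < b'\<close> are fully reversed; the two first
        steps lead on to this list along the two sides of the braid relation.\<close>
      obtain h where h: "key_rel (A @ b' # b # a # B') h" using key_rel_total by blast
      have "key_rel (A @ b # b' # a # B') (xi (length A) h)"
        using key_rel.step[of A b' b "a # B'"] h ab by simp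
      then have "key_rel ((A @ [b]) @ a # b' # B') (xi (Suc (length A)) (xi (length A) h))"
        using key_rel.step[of "A @ [b]" b' a B'] ab by simp
      then have 1: "f' = xi (Suc (length A)) (xi (length A) h)"
        using less(1)[OF wf f'] near by simp
      have "key_rel ((A @ [b']) @ a # b # B') (xi (Suc (length A)) h)"
        using key_rel.step[of "A @ [b']" b a B'] h ab by simp
      then have "key_rel (A @ a # b' # b # B') (xi (length A) (xi (Suc (length A)) h))"
        using key_rel.step[of A b' a "b # B'"] ab by simp
      then have 2: "g' = xi (length A) (xi (Suc (length A)) h)"
        using less(1)[OF wg g'] near by simp
      show ?thesis using near by (simp add: 1 2 xi_braid)
    qed
  qed
  from less(2) show ?case
  proof cases
    case base
    from less(3) show ?thesis
      by cases (use base sorted_no_ascent in fastforce)+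
  next
    case f: (step A b a B f')
    from less(3) show ?thesis
    proof cases
      case base
      then show ?thesis using f sorted_no_ascent by fastforce
    next
      case g: (step A' b' a' B' g')
      consider "length A < length A'" | "length A' < length A" | "length A = length A'" by linarith
      then show ?thesis
      proof cases
        case 1
        show ?thesis using main[OF f(1) g(1) f(4) g(4) 1 f(3) g(3)] f(2) g(2) by simp
      next
        case 2
        show ?thesis using main[OF g(1) f(1) g(4) f(4) 2 g(3) f(3)] f(2) g(2) by simp
      next
        case 3
        then have "A' @ b' # a' # B' = A @ b # a # B" using f(1) g(1) by simp
        then have "f' = g'"
          using less(1)[OF _ f(3)] g(3) weight_swap_less[OF f(4)] f(1) by simp
        then show ?thesis using f(2) g(2) 3 by simp
      qed
    qed
  qed
qed

lemma is_key_family_ex: "\<exists>K. is_key_family K"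
proof -
  define K where "K \<alpha> = (THE f. key_rel \<alpha> f)" for \<alpha>
  have K: "K \<alpha> = f" if "key_rel \<alpha> f" for \<alpha> f
    unfolding K_def using that key_rel_unique by blast
  have "K (A @ a # b # B) = xi (length A) (K (A @ b # a # B))" if "a < b" for A a b B
    using key_rel_total[of "A @ b # a # B"] K key_rel.step[OF _ that] by metis
  then show ?thesis
    unfolding is_key_family_iff using K key_rel.base by blast
qed

lemma is_key_family_unique:
  assumes "is_key_family K" "is_key_family K'"
  shows "K = K'"
proof
  fix \<alpha>
  have "K \<alpha> = f \<and> K' \<alpha> = f" if "key_rel \<alpha> f" for f
    using that by induction (use assms in \<open>auto simp: is_key_family_iff\<close>)
  then show "K \<alpha> = K' \<alpha>" using key_rel_total by metis
qed

lemma is_key_family_key_poly: "is_key_family key_poly"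
  unfolding key_poly_def
  using is_key_family_ex is_key_family_unique by (metis theI)

lemma key_poly_sorted: "sorted_wrt (\<ge>) \<alpha> \<Longrightarrow> key_poly \<alpha> = mon (Poly_Mapping.nth \<alpha>) 1"
  and key_poly_ascent: "a < b \<Longrightarrow> key_poly (A @ a # b # B) = xi (length A) (key_poly (A @ b # a # B))"
  using is_key_family_key_poly by (simp_all add: is_key_family_iff)

lemma composition_induct [case_names sorted ascent]:
  fixes P :: "nat list \<Rightarrow> bool"
  assumes "\<And>\<alpha>. sorted_wrt (\<ge>) \<alpha> \<Longrightarrow> P \<alpha>"
    "\<And>A a b B. P (A @ b # a # B) \<Longrightarrow> a < b \<Longrightarrow> P (A @ a # b # B)"
  shows "P \<alpha>"
proof -
  obtain f where "key_rel \<alpha> f" using key_rel_total by blast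
  then show ?thesis by induction (use assms in auto)
qed


section \<open>Coefficients of key polynomials\<close>

abbreviation key_coeff :: "nat list \<Rightarrow> nat list \<Rightarrow> int" where
  "key_coeff \<alpha> \<equiv> list_coeff (key_poly \<alpha>)"

lemma nth_poly_eq_iff:
  assumes "length a = length b"
  shows "Poly_Mapping.nth a = Poly_Mapping.nth b \<longleftrightarrow> a = (b :: nat list)"
proof
  assume eq: "Poly_Mapping.nth a = Poly_Mapping.nth b"
  show "a = b"
  proof (rule nth_equalityI[OF assms])
    fix i assume "i < length a"
    then show "a ! i = b ! i"
      using arg_cong[OF eq, of "\<lambda>e. Poly_Mapping.lookup e i"] assms by (simp add: nth_default_nth)
  qed
qed simp

lemma key_coeff_sorted:
  "sorted_wrt (\<ge>) \<alpha> \<Longrightarrow> length a = length \<alpha> \<Longrightarrow> key_coeff \<alpha> a = (if a = \<alpha> then 1 else 0)"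
  by (auto simp: key_poly_sorted lookup_single when_def nth_poly_eq_iff)

lemma key_coeff_ascent:
  assumes "a < b" "length A' = length A"
  shows "key_coeff (A @ a # b # B) (A' @ p # q # B') =
     (\<Sum>u = max p q..p + q. key_coeff (A @ b # a # B) (A' @ u # (p + q - u) # B')) -
     (\<Sum>u = Suc (max p q)..p + q. key_coeff (A @ b # a # B) (A' @ (p + q - u) # u # B'))"
  using list_coeff_xi[of A' "key_poly (A @ b # a # B)" p q B'] assms
  by (simp add: key_poly_ascent)

lemma key_coeff_ascent_zero:
  assumes "a < b" "length A' = length A"
  shows "key_coeff (A @ a # b # B) (A' @ 0 # q # B') = key_coeff (A @ b # a # B) (A' @ q # 0 # B')"
  using list_coeff_xi_rec(1)[of A' "key_poly (A @ b # a # B)" q B'] assms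
  by (simp add: key_poly_ascent)

lemma list_split_lengths:
  assumes "length x = length (A @ B)"
  obtains A' B' where "x = A' @ B'" "length A' = length A" "length B' = length B"
  using assms that[of "take (length A) x" "drop (length A) x"] by simp

lemma list_split_middle2:
  assumes "length x = length (A @ a # b # B)"
  obtains A' p q B' where "x = A' @ p # q # B'" "length A' = length A" "length B' = length B"
proof -
  from assms obtain A' C where "x = A' @ C" "length A' = length A" "length C = length (a # b # B)"
    by (rule list_split_lengths)
  moreover from this(3) obtain p q B' where "C = p # q # B'" "length B' = length B"
    by (auto simp: length_Suc_conv)
  ultimately show ?thesis using that by blast
qed

text \<open>\<open>xi\<close> redistributes the exponents of two adjacent variables without changing
  their sum. The list \<open>x\<close> may be longer than \<open>\<alpha>\<close>, so that variables
  beyond the entries of \<open>\<alpha>\<close> are excluded as well.\<close>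

lemma key_coeff_support:
  assumes "length \<alpha> \<le> length x" "key_coeff \<alpha> x \<noteq> 0"
  shows "set (drop (length \<alpha>) x) \<subseteq> {0}" "sum_list x = sum_list \<alpha>"
proof -
  have "set (drop (length \<alpha>) x) \<subseteq> {0} \<and> sum_list x = sum_list \<alpha>"
    using assms
  proof (induction \<alpha> arbitrary: x rule: composition_induct)
    case (sorted \<alpha>)
    let ?\<alpha> = "\<alpha> @ replicate (length x - length \<alpha>) 0"
    from sorted have "Poly_Mapping.nth x = Poly_Mapping.nth \<alpha>"
      by (auto simp: key_poly_sorted lookup_single when_def split: if_splits)
    also have "\<dots> = Poly_Mapping.nth ?\<alpha>" by simp
    finally have "x = ?\<alpha>" using sorted by (subst (asm) nth_poly_eq_iff) auto
    then show ?case by (metis append_eq_conv_conj set_replicate_conv_if subset_refl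
          empty_subsetI sum_list_append sum_list_replicate mult_zero_right add_0_right)
  next
    case (ascent A a b B)
    let ?n = "length (A @ a # b # B)"
    from ascent.prems(1) have "length (take ?n x) = length (A @ a # b # B)" by simp
    then obtain A' p q C where "take ?n x = A' @ p # q # C" "length A' = length A" "length C = length B"
      by (rule list_split_middle2)
    moreover define B' where "B' = C @ drop ?n x"
    ultimately have x: "x = A' @ p # q # B'" "length A' = length A"
      using append_take_drop_id[of ?n x] by simp_all
    from ascent.prems(2) have "\<exists>u v. u + v = p + q \<and> key_coeff (A @ b # a # B) (A' @ u # v # B') \<noteq> 0"
      unfolding x(1) key_coeff_ascent[OF ascent.hyps x(2)]
      by (rule contrapos_np) (force intro!: sum.neutral simp: not_less)
    then obtain u v where uv: "u + v = p + q" "key_coeff (A @ b # a # B) (A' @ u # v # B') \<noteq> 0" by blast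
    from ascent.IH[OF _ uv(2)] ascent.prems(1)
    have "set (drop ?n (A' @ u # v # B')) \<subseteq> {0} \<and> sum_list (A' @ u # v # B') = sum_list (A @ b # a # B)"
      by (simp add: x)
    then show ?case using uv(1) by (simp add: x)
  qed
  then show "set (drop (length \<alpha>) x) \<subseteq> {0}" "sum_list x = sum_list \<alpha>" by auto
qed

lemma keys_key_poly:
  assumes "e \<in> Poly_Mapping.keys (key_poly \<alpha>)"
  shows "Poly_Mapping.keys e \<subseteq> {..<length \<alpha>}"
proof
  fix v assume v: "v \<in> Poly_Mapping.keys e"
  \<comment> \<open>Long enough for \<open>x\<close> to record all of \<open>e\<close>, to have an
    entry at \<open>v\<close> and to be at least as long as \<open>\<alpha>\<close>.\<close>
  define n where "n = Suc (v + length \<alpha> + Max (Poly_Mapping.keys e))"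
  define x where "x = map (Poly_Mapping.lookup e) [0..<n]"
  have "e = Poly_Mapping.nth x"
  proof (rule poly_mapping_eqI)
    fix w
    have "w < n" if "w \<in> Poly_Mapping.keys e"
      using Max_ge[OF finite_keys that] by (simp add: n_def)
    then show "Poly_Mapping.lookup e w = Poly_Mapping.lookup (Poly_Mapping.nth x) w"
      by (auto simp: x_def nth_default_def in_keys_iff)
  qed
  with assms have "key_coeff \<alpha> x \<noteq> 0" by (simp add: in_keys_iff)
  then have "set (drop (length \<alpha>) x) \<subseteq> {0}"
    by (intro key_coeff_support) (simp add: x_def n_def)
  moreover have "x ! v \<in> set (drop (length \<alpha>) x)" if "length \<alpha> \<le> v"
    using that nth_mem[of "v - length \<alpha>" "drop (length \<alpha>) x"] by (simp add: x_def n_def del: upt_Suc)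
  moreover have "x ! v \<noteq> 0" using v by (simp add: x_def n_def in_keys_iff del: upt_Suc)
  ultimately show "v \<in> {..<length \<alpha>}" by force
qed

subsection \<open>Symmetry\<close>

text \<open>The operator commutes with one for an ascent disjoint from the equal pair. If the ascent
  overlaps the pair, the braid relation carries the operator to a key polynomial with the equal pair
  at the shifted position, where the induction hypothesis absorbs it.\<close>

lemma xi_key_poly_equal:
  "xi (length A) (key_poly (A @ a # a # B)) = key_poly (A @ a # a # B)"
proof (induction "weight (A @ a # a # B)" arbitrary: A B rule: less_induct)
  case less
  define \<alpha> where "\<alpha> = A @ a # a # B"
  show ?case
  proof (cases "sorted_wrt (\<ge>) \<alpha>")
    case True
    then show ?thesis
      by (intro xi_eq_self) (simp add: key_poly_sorted rename_monomial_transpose_nth \<alpha>_def)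
  next
    case False
    then obtain C c d D where *: "\<alpha> = C @ c # d # D" "c < d" by (rule not_sorted_ascent)
    have key: "key_poly \<alpha> = xi (length C) (key_poly (C @ d # c # D))"
      using * key_poly_ascent by simp
    have w: "weight (C @ d # c # D) < weight (A @ a # a # B)"
      using weight_swap_less[OF *(2), of C D] *(1) by (simp add: \<alpha>_def)
    consider "length A < length C" | "length C < length A" | "length A = length C" by linarith
    then have "xi (length A) (key_poly \<alpha>) = key_poly \<alpha>"
    proof cases
      case 1
      from \<alpha>_def *(1) 1 show ?thesis
      proof (cases rule: adjacent_pairs_cases)
        case (far E)
        then have "xi (length A) (key_poly (C @ d # c # D)) = key_poly (C @ d # c # D)"
          using less[of A "E @ d # c # D"] w by simp
        then show ?thesis using xi_commute[of "length A" "length C"] far by (simp add: key)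
      next
        case near
        then have eq: "c = a" "C @ d # c # D = A @ a # d # a # D" by simp_all
        let ?h = "key_poly (A @ d # a # a # D)"
        have "key_poly (C @ d # c # D) = xi (length A) ?h"
          using key_poly_ascent[of a d A "a # D"] *(2) eq by simp
        then have k: "key_poly \<alpha> = xi (Suc (length A)) (xi (length A) ?h)"
          using near(1) key by simp
        have "weight (A @ d # a # a # D) < weight (A @ a # d # a # D)"
          using weight_swap_less[of a d A "a # D"] *(2) eq by simp
        then have "xi (Suc (length A)) ?h = ?h"
          using less[of "A @ [d]" D] w eq by simp
        then show ?thesis unfolding k xi_braid by simp
      qed
    next
      case 2
      from *(1) \<alpha>_def 2 show ?thesis
      proof (cases rule: adjacent_pairs_cases)
        case (far E)
        then have "xi (length A) (key_poly (C @ d # c # D)) = key_poly (C @ d # c # D)"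
          using less[of "C @ d # c # E" B] w by simp
        moreover have "Suc (length C) < length A" using far by simp
        ultimately show ?thesis unfolding key by (metis xi_commute)
      next
        case near
        then have eq: "d = a" "C @ d # c # D = (C @ [a]) @ c # a # B" by simp_all
        let ?h = "key_poly (C @ a # a # c # B)"
        have "key_poly (C @ d # c # D) = xi (Suc (length C)) ?h"
          using key_poly_ascent[of c a "C @ [a]" B] *(2) eq by simp
        then have k: "key_poly \<alpha> = xi (length C) (xi (Suc (length C)) ?h)"
          using key by simp
        have "weight (C @ a # a # c # B) < weight (C @ a # c # a # B)"
          using weight_swap_less[of c a "C @ [a]" B] *(2) eq by simp
        then have "xi (length C) ?h = ?h"
          using less[of C "c # B"] w eq by simp
        then show ?thesis unfolding k using near xi_braid[of "length C" ?h] by simp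
      qed
    next
      case 3
      then show ?thesis using * \<alpha>_def by simp
    qed
    then show ?thesis by (simp add: \<alpha>_def)
  qed
qed

text \<open>For \<open>a < b\<close> the polynomial is a value of the operator, for
  \<open>a = b\<close> it is fixed by it; either way it is symmetric in the two variables.\<close>

lemma key_coeff_swap:
  assumes "a \<le> b" "length A' = length A"
  shows "key_coeff (A @ a # b # B) (A' @ p # q # B') = key_coeff (A @ a # b # B) (A' @ q # p # B')"
proof -
  have "xi (length A) (key_poly (A @ a # b # B)) = key_poly (A @ a # b # B)"
    using assms(1) xi_key_poly_equal key_poly_ascent[of a b A B] by (cases "a = b") auto
  then have "swap_vars (length A') (key_poly (A @ a # b # B)) = key_poly (A @ a # b # B)"
    using assms(2) by (metis swap_vars_xi)
  then show ?thesis
    using list_coeff_swap_vars[of A' "key_poly (A @ a # b # B)" p q B'] by simp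
qed

text \<open>The exponent \<open>x\<close> moves forward by adjacent exchanges, each at two
  neighbouring entries of the weakly increasing list \<open>B\<close>.\<close>

lemma key_coeff_move:
  assumes "sorted B" "length P' = length P" "length B = Suc (length u + length v)"
  shows "key_coeff (P @ B @ Q) (P' @ u @ x # v @ Q') = key_coeff (P @ B @ Q) (P' @ x # u @ v @ Q')"
  using assms
proof (induction u arbitrary: P P' B)
  case (Cons y u)
  then obtain a b C where B: "B = a # b # C" by (auto simp: length_Suc_conv)
  have "key_coeff (P @ B @ Q) (P' @ (y # u) @ x # v @ Q') =
      key_coeff (P @ B @ Q) (P' @ y # x # u @ v @ Q')"
    using Cons.IH[of "b # C" "P' @ [y]" "P @ [a]"] Cons.prems by (simp add: B)
  also have "\<dots> = key_coeff (P @ B @ Q) (P' @ x # y # u @ v @ Q')"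
    using key_coeff_swap[of a b P' P "C @ Q" y x "u @ v @ Q'"] Cons.prems by (simp add: B)
  finally show ?case by simp
qed simp

text \<open>The first entry of \<open>b\<close> is located in \<open>b'\<close> and moved to the
  front; the remaining entries follow by induction with extended prefixes.\<close>

lemma key_coeff_block_perm:
  assumes "sorted B" "length P' = length P" "length b = length B" "mset b = mset b'"
  shows "key_coeff (P @ B @ Q) (P' @ b @ Q') = key_coeff (P @ B @ Q) (P' @ b' @ Q')"
  using assms
proof (induction b arbitrary: P P' B b')
  case (Cons x b)
  then have "x \<in> set b'" by (metis list.set_intros(1) mset_eq_setD)
  then obtain u v where b': "b' = u @ x # v" by (auto dest: split_list)
  from Cons.prems obtain a C where B: "B = a # C" by (cases B) auto
  from Cons.prems(4) have uv: "mset b = mset (u @ v)" by (simp add: b')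
  then have "length b = length u + length v" by (metis length_append mset_eq_length)
  then have "key_coeff (P @ B @ Q) (P' @ b' @ Q') = key_coeff (P @ B @ Q) (P' @ x # u @ v @ Q')"
    using key_coeff_move[of B P' P u v] Cons.prems by (simp add: b')
  also have "\<dots> = key_coeff (P @ B @ Q) (P' @ x # b @ Q')"
    using Cons.IH[of C "P' @ [x]" "P @ [a]" "u @ v"] Cons.prems uv by (simp add: B)
  finally show ?case by simp
qed simp

subsection \<open>Stability\<close>

lemma sorted_wrt_delete: "sorted_wrt R (A @ x # B) \<Longrightarrow> sorted_wrt R (A @ B)"
  by (auto simp: sorted_wrt_append)

text \<open>
  Setting a variable with index entry 0 to 0 commutes with every $\xi_i$ that does not involve
  it; at an ascent $0 < d$, it turns $\xi_i f$ into $f$ with the other of the two variables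
  set to 0.
\<close>

lemma key_coeff_delete_zero:
  assumes "length A' = length A" "length B' = length B"
  shows "key_coeff (A @ 0 # B) (A' @ 0 # B') = key_coeff (A @ B) (A' @ B')"
proof -
  define \<alpha> where "\<alpha> = A @ 0 # B"
  have "key_coeff \<alpha> (A' @ 0 # B') = key_coeff (A @ B) (A' @ B')"
    using \<alpha>_def assms
  proof (induction \<alpha> arbitrary: A B A' B' rule: composition_induct)
    case (sorted \<alpha>)
    then have "sorted_wrt (\<ge>) (A @ B)" using sorted_wrt_delete[of _ A 0 B] by simp
    then show ?case using sorted by (simp add: key_coeff_sorted)
  next
    case (ascent C c d D)
    note len = ascent.prems(2,3)
    from ascent.prems(1) have eq: "A @ (0 # B) = C @ (c # d # D)" by simp
    \<comment> \<open>The deleted zero lies left of the ascent, is its lower entry, would be its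
      upper entry (impossible, as \<open>c < d\<close>), or lies to the right.\<close>
    consider "length A < length C" | "length A = length C" | "length A = Suc (length C)"
      | "Suc (length C) < length A" by linarith
    then show ?case
    proof cases
      case 1
      then obtain E where E: "C = A @ E" "0 # B = E @ c # d # D" "E \<noteq> []"
        using eq by (auto simp: append_eq_append_conv2)
      then obtain C' where C: "C = A @ 0 # C'" "B = C' @ c # d # D" by (cases E) auto
      obtain C'' p q D' where B': "B' = C'' @ p # q # D'" "length C'' = length C'" "length D' = length D"
        using len(2) unfolding C by (rule list_split_middle2)
      have IH: "key_coeff (C @ d # c # D) (A' @ 0 # C'' @ u # v # D') =
          key_coeff (A @ C' @ d # c # D) (A' @ C'' @ u # v # D')" for u v
        using ascent.IH[of A "C' @ d # c # D" A' "C'' @ u # v # D'"] C B' len by simp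
      show ?thesis
        using key_coeff_ascent[OF ascent.hyps, of "A' @ 0 # C''" C D p q D']
          key_coeff_ascent[OF ascent.hyps, of "A' @ C''" "A @ C'" D p q D'] C B' len
        by (simp add: IH[unfolded C, simplified])
    next
      case 2
      then have C: "C = A" "c = 0" "B = d # D" using eq by simp_all
      from len C obtain q D' where B': "B' = q # D'" "length D' = length D"
        by (auto simp: length_Suc_conv)
      have "key_coeff (A @ d # 0 # D) (A' @ q # 0 # D') = key_coeff (A @ d # D) (A' @ q # D')"
        using ascent.IH[of "A @ [d]" D "A' @ [q]" D'] C B' len by simp
      then show ?thesis
        using key_coeff_ascent_zero[of 0 d A' A D q D'] C B' len ascent.hyps by simp
    next
      case 3
      then have "d = 0" using eq by (auto simp: append_eq_append_conv2 append_eq_Cons_conv)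
      then show ?thesis using ascent.hyps by simp
    next
      case 4
      then obtain E where E: "A = C @ E" "E @ 0 # B = c # d # D" "Suc 0 < length E"
        using eq by (auto simp: append_eq_append_conv2)
      then obtain C' where C: "A = C @ c # d # C'" "D = C' @ 0 # B"
        by (auto simp: append_eq_Cons_conv)
      obtain C'' p q D' where A': "A' = C'' @ p # q # D'" "length C'' = length C" "length D' = length C'"
        using len(1) unfolding C by (rule list_split_middle2)
      have IH: "key_coeff (C @ d # c # D) (C'' @ u # v # D' @ 0 # B') =
          key_coeff (C @ d # c # C' @ B) (C'' @ u # v # D' @ B')" for u v
        using ascent.IH[of "C @ d # c # C'" B "C'' @ u # v # D'" B'] C A' len by simp
      show ?thesis
        using key_coeff_ascent[OF ascent.hyps, of C'' C D p q "D' @ 0 # B'"]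
          key_coeff_ascent[OF ascent.hyps, of C'' C "C' @ B" p q "D' @ B'"] C A' len
        by (simp add: IH[unfolded C, simplified])
    qed
  qed
  then show ?thesis by (simp add: \<alpha>_def)
qed

lemma key_coeff_delete_zeros:
  assumes "length A' = length A" "length B' = length B"
  shows "key_coeff (A @ replicate k 0 @ B) (A' @ replicate k 0 @ B') = key_coeff (A @ B) (A' @ B')"
  by (induction k) (use assms in \<open>simp_all add: key_coeff_delete_zero\<close>)

subsection \<open>Triangularity\<close>

text \<open>\<open>b\<close> stands to the right of the smaller entries \<open>C\<close>, although
  decreasing order would put it before them. Undoing its exchange with the last entry of
  \<open>C\<close> moves that entry into the tail, so \<open>E\<close> and \<open>e\<close> vary in
  the induction.\<close>

lemma key_coeff_insert_last:
  assumes "sorted_wrt (\<ge>) (A @ b # C @ E)" "\<forall>c\<in>set C. c < b"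
    and "length x = length (A @ C)" "length e = length E" "b \<le> p \<or> e \<noteq> E"
  shows "key_coeff (A @ C @ b # E) (x @ p # e) = (if x = A @ C \<and> p = b \<and> e = E then 1 else 0)"
  using assms
proof (induction C arbitrary: E x p e rule: rev_induct)
  case Nil
  then show ?case by (simp add: key_coeff_sorted)
next
  case (snoc c C)
  from snoc.prems(3) have "length x = length ((A @ C) @ [c])" by simp
  then obtain y z where "x = y @ z" and y: "length y = length (A @ C)" and "length z = length [c]"
    by (rule list_split_lengths)
  then obtain q where x: "x = y @ [q]" by (auto simp: length_Suc_conv)
  define F where "F u v = key_coeff ((A @ C) @ b # c # E) (y @ u # v # e)" for u v
  have cb: "c < b" using snoc.prems by simp
  have F: "F u v = (if y = A @ C \<and> u = b \<and> v = c \<and> e = E then 1 else 0)"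
    if "b \<le> u \<or> v \<noteq> c \<or> e \<noteq> E" for u v
    using snoc.IH[of "c # E" y "v # e" u] snoc.prems y that by (auto simp: F_def)
  have "key_coeff (A @ (C @ [c]) @ b # E) (x @ p # e) =
      (\<Sum>u = max q p..q + p. F u (q + p - u)) - (\<Sum>u = Suc (max q p)..q + p. F (q + p - u) u)"
    using key_coeff_ascent[OF cb, of y "A @ C" E q p e] y by (simp add: x F_def)
  \<comment> \<open>If \<open>e = E\<close>, then \<open>u > p \<ge> b > c\<close>, so the second
    exponent is not \<open>c\<close>; if \<open>e \<noteq> E\<close>, then \<open>F\<close> vanishes
    anyway.\<close>
  also have "(\<Sum>u = Suc (max q p)..q + p. F (q + p - u) u) = 0"
  proof (rule sum.neutral, rule ballI)
    fix u assume "u \<in> {Suc (max q p)..q + p}"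
    then have "u \<noteq> c \<or> e \<noteq> E" using snoc.prems(5) cb by auto
    then show "F (q + p - u) u = 0" using F[of u "q + p - u"] F[of "q + p - u" u] by auto
  qed
  also have "(\<Sum>u = max q p..q + p. F u (q + p - u)) =
      (\<Sum>u = max q p..q + p. if u = b then if y = A @ C \<and> q + p - b = c \<and> e = E then 1 else 0 else 0)"
    by (rule sum.cong) (use F snoc.prems(5) in auto)
  also have "\<dots> = (if max q p \<le> b \<and> b \<le> q + p \<and> y = A @ C \<and> q + p - b = c \<and> e = E then 1 else 0)"
    by auto
  \<comment> \<open>With \<open>e = E\<close>, \<open>b \<le> p\<close> and
    \<open>max q p \<le> b\<close> give \<open>p = b\<close>, and then \<open>q = c\<close>.\<close>
  also have "\<dots> = (if x = A @ (C @ [c]) \<and> p = b \<and> e = E then 1 else 0)"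
    using snoc.prems(5) cb by (auto simp: x)
  finally show ?case by simp
qed

text \<open>The operators for ascents of \<open>\<gamma>\<close> do not touch the last variable, so
  they act separately on the coefficient of each of its powers. This reduces the claim to weakly
  decreasing \<open>\<gamma>\<close>.\<close>

lemma key_coeff_last:
  assumes "length x = length \<gamma>" "g \<le> d"
  shows "key_coeff (\<gamma> @ [g]) (x @ [d]) = (if d = g then key_coeff \<gamma> x else 0)"
  using assms(1)
proof (induction \<gamma> arbitrary: x rule: composition_induct)
  case (sorted \<gamma>)
  \<comment> \<open>In decreasing order \<open>g\<close> would stand between \<open>A\<close> and
    \<open>C\<close>; it has been moved past the entries of \<open>C\<close>, all smaller than
    \<open>g\<close>.\<close>
  define A where "A = takeWhile (\<lambda>y. g \<le> y) \<gamma>"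
  define C where "C = dropWhile (\<lambda>y. g \<le> y) \<gamma>"
  have \<gamma>: "\<gamma> = A @ C" by (simp add: A_def C_def)
  have A: "\<forall>y\<in>set A. g \<le> y" unfolding A_def by (meson set_takeWhileD)
  have C: "\<forall>y\<in>set C. y < g"
  proof (cases C)
    case (Cons c C')
    then have "c < g" using hd_dropWhile[of "\<lambda>y. g \<le> y" \<gamma>] C_def by auto
    then show ?thesis using sorted(1) \<gamma> Cons by (fastforce simp: sorted_wrt_append)
  qed simp
  have "sorted_wrt (\<ge>) (A @ g # C @ [])"
    using sorted(1) A C unfolding \<gamma> by (fastforce simp: sorted_wrt_append)
  from key_coeff_insert_last[OF this C, of x "[]" d]
  have "key_coeff (\<gamma> @ [g]) (x @ [d]) = (if x = \<gamma> \<and> d = g then 1 else 0)"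
    using sorted(2) assms(2) by (simp add: \<gamma>)
  then show ?case using sorted by (simp add: key_coeff_sorted)
next
  case (ascent A a b B)
  from ascent.prems obtain A' p q B' where x: "x = A' @ p # q # B'" "length A' = length A" "length B' = length B"
    by (rule list_split_middle2)
  have IH: "key_coeff (A @ b # a # B @ [g]) (A' @ u # v # B' @ [d]) =
      (if d = g then key_coeff (A @ b # a # B) (A' @ u # v # B') else 0)" for u v
    using ascent.IH[of "A' @ u # v # B'"] x by simp
  show ?case
    using key_coeff_ascent[OF ascent.hyps, of A' A "B @ [g]" p q "B' @ [d]"]
      key_coeff_ascent[OF ascent.hyps, of A' A B p q B'] x by (simp add: IH)
qed

text \<open>Comparison at the last differing place; lists of different lengths are never
  related.\<close>

fun colex_less :: "nat list \<Rightarrow> nat list \<Rightarrow> bool" where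
  "colex_less (x # xs) (y # ys) \<longleftrightarrow> colex_less xs ys \<or> xs = ys \<and> x < y"
| "colex_less _ _ \<longleftrightarrow> False"

lemma colex_less_append:
  assumes "length a = length c" "length b = length d"
  shows "colex_less (a @ b) (c @ d) \<longleftrightarrow> colex_less b d \<or> b = d \<and> colex_less a c"
  using assms(1)
proof (induction a c rule: list_induct2)
  case Nil
  have "\<not> colex_less [] []" by simp
  then show ?case by simp
qed (use assms(2) in auto)

text \<open>Entries are compared from the right: a smaller last exponent settles the order, an equal
  one passes to the remaining entries, and a larger one has coefficient 0.\<close>

lemma key_coeff_triangular:
  assumes "length x = length \<gamma>"
  shows "key_coeff \<gamma> \<gamma> = 1" "key_coeff \<gamma> x \<noteq> 0 \<Longrightarrow> x = \<gamma> \<or> colex_less x \<gamma>"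
proof -
  show "key_coeff \<gamma> \<gamma> = 1"
  proof (induction \<gamma> rule: rev_induct)
    case Nil
    show ?case using key_coeff_sorted[of "[]" "[]"] by simp
  qed (simp add: key_coeff_last)
  show "x = \<gamma> \<or> colex_less x \<gamma>" if "key_coeff \<gamma> x \<noteq> 0"
    using that assms
  proof (induction \<gamma> arbitrary: x rule: rev_induct)
    case (snoc g \<gamma>)
    then obtain y d where x: "x = y @ [d]" "length y = length \<gamma>"
      by (metis length_append_singleton length_Suc_conv_rev)
    show ?case
    proof (cases "d < g")
      case True
      then show ?thesis using x colex_less_append[of y \<gamma> "[d]" "[g]"] by simp
    next
      case False
      then have "d = g" "key_coeff \<gamma> y \<noteq> 0"
        using snoc.prems(1) x key_coeff_last[of y \<gamma> g d] by (auto split: if_splits)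
      then show ?thesis
        using snoc.IH[of y] x colex_less_append[of y \<gamma> "[d]" "[g]"] by auto
    qed
  qed simp
qed


section \<open>Tuples of partitions and their blocks\<close>

definition block :: "nat list \<Rightarrow> nat \<Rightarrow> nat list" where
  "block p n = replicate (n - length p) 0 @ rev p"

lemma length_block [simp]: "length p \<le> n \<Longrightarrow> length (block p n) = n"
  by (simp add: block_def)

lemma block_comp_Nil [simp]: "block_comp [] ns = []"
  by (simp add: block_comp_def)

lemma block_comp_Cons [simp]: "block_comp (p # ps) (n # ns) = block p n @ block_comp ps ns"
  by (simp add: block_comp_def block_def)

abbreviation fits :: "nat list list \<Rightarrow> nat list \<Rightarrow> bool" where
  "fits \<equiv> list_all2 (\<lambda>p n. length p \<le> n)"

lemma sum_list_concat: "sum_list (concat xs) = sum_list (map sum_list xs)"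
  for xs :: "nat list list"
  by (induction xs) auto

lemma length_block_comp: "fits ps ns \<Longrightarrow> length (block_comp ps ns) = sum_list ns"
  by (induction rule: list_all2_induct) auto

lemma sum_list_block_comp: "length ps = length ns \<Longrightarrow> sum_list (block_comp ps ns) = sum_list (concat ps)"
  by (induction ps ns rule: list_induct2) (auto simp: block_def sum_list_replicate)

lemma sorted_block: "p \<in> Par \<Longrightarrow> sorted (block p n)"
  by (auto simp: block_def Par_def sorted_append sorted_wrt_rev)

text \<open>Parts are positive, so removing the zeros from a block recovers the partition.\<close>

lemma block_inject:
  assumes "p \<in> Par" "q \<in> Par" "block p n = block q n"
  shows "p = q"
proof -
  have "filter (\<lambda>x. x \<noteq> 0) (block r n) = rev r" if "r \<in> Par" for r
    using that by (auto simp: block_def Par_def filter_id_conv) (metis gr0I)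
  then show ?thesis using assms by (metis rev_rev_ident)
qed

section \<open>Comparison of the orders on blocks and on partitions\<close>

lemma lex_less_irrefl: "\<not> lex_less p p"
  by (simp add: lex_less_def)

lemma tuple_less_irrefl: "\<not> tuple_less r ps ps"
  by (simp add: tuple_less_def lex_less_irrefl)

lemma colex_less_rev:
  assumes "length a = length b" "colex_less (rev a) (rev b)"
  shows "lex_less a b"
  using assms
proof (induction a b rule: list_induct2)
  case (Cons x a y b)
  then consider "x < y" | "x = y" "colex_less (rev a) (rev b)"
    by (auto simp: colex_less_append)
  then show ?case
  proof cases
    case 1
    then show ?thesis unfolding lex_less_def by (intro exI[of _ 0]) auto
  next
    case 2
    then obtain k where "\<forall>i<k. nth_default 0 a i = nth_default 0 b i" "nth_default 0 a k < nth_default 0 b k"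
      using Cons.IH by (auto simp: lex_less_def)
    then show ?thesis
      unfolding lex_less_def using 2 by (intro exI[of _ "Suc k"]) (auto simp: less_Suc_eq_0_disj)
  qed
qed simp

text \<open>A block is the reversal of the partition padded with zeros at the end, and
  \<open>lex_less\<close> reads missing parts as 0.\<close>

lemma colex_less_block:
  assumes "length p \<le> n" "length q \<le> n" "colex_less (block p n) (block q n)"
  shows "lex_less p q"
proof -
  have "lex_less (p @ replicate (n - length p) 0) (q @ replicate (n - length q) 0)"
    by (rule colex_less_rev) (use assms in \<open>simp_all add: block_def\<close>)
  moreover have "nth_default 0 (r @ replicate k 0) i = nth_default 0 r i" for r :: "nat list" and k i
    by (auto simp: nth_default_def nth_append)
  ultimately show ?thesis by (simp add: lex_less_def)
qed

lemma block_comp_inject: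
  assumes "fits ps ns" "fits qs ns" "set ps \<subseteq> Par" "set qs \<subseteq> Par"
    and "block_comp ps ns = block_comp qs ns"
  shows "ps = qs"
  using assms
proof (induction ps ns arbitrary: qs rule: list_all2_induct)
  case (Cons p ps n ns)
  then obtain q qs' where "qs = q # qs'" by (auto simp: list_all2_Cons2)
  with Cons.prems Cons.hyps have "block p n = block q n" "block_comp ps ns = block_comp qs' ns"
    by simp_all
  then show ?case
    using Cons.IH[of qs'] Cons.prems block_inject[of p q n] \<open>qs = q # qs'\<close> by simp
qed simp

lemma tuple_less_Cons:
  "tuple_less r ps qs \<Longrightarrow> tuple_less (Suc r) (p # ps) (q # qs)"
  "lex_less p q \<Longrightarrow> tuple_less (Suc r) (p # ps) (q # ps)"
proof -
  assume "tuple_less r ps qs"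
  then obtain k where "k < r" "\<forall>i. k < i \<and> i < r \<longrightarrow> ps ! i = qs ! i" "lex_less (ps ! k) (qs ! k)"
    by (auto simp: tuple_less_def)
  then show "tuple_less (Suc r) (p # ps) (q # qs)"
    unfolding tuple_less_def
    by (intro exI[of _ "Suc k"]) (auto simp: nth_Cons split: nat.split)
next
  assume "lex_less p q"
  then show "tuple_less (Suc r) (p # ps) (q # ps)"
    unfolding tuple_less_def by (intro exI[of _ 0]) auto
qed

text \<open>The last difference of the concatenations lies in the last differing block, which is the
  component that \<open>tuple_less\<close> compares.\<close>

lemma colex_less_block_comp:
  assumes "fits ps ns" "fits qs ns" "set ps \<subseteq> Par" "set qs \<subseteq> Par"
    and "colex_less (block_comp ps ns) (block_comp qs ns)"
  shows "tuple_less (length ps) ps qs"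
  using assms
proof (induction ps ns arbitrary: qs rule: list_all2_induct)
  case (Cons p ps n ns)
  then obtain q qs' where qs: "qs = q # qs'" "length q \<le> n" "fits qs' ns"
    by (auto simp: list_all2_Cons2)
  with Cons have "colex_less (block_comp ps ns) (block_comp qs' ns) \<or>
      block_comp ps ns = block_comp qs' ns \<and> colex_less (block p n) (block q n)"
    by (simp add: colex_less_append length_block_comp)
  then show ?case
    using Cons qs block_comp_inject[of ps ns qs'] colex_less_block[of p n q]
    by (auto intro: tuple_less_Cons)
qed simp


section \<open>Stable coefficients\<close>

text \<open>Blocks are rearranged one after another; the prefixes hold those already done.\<close>

lemma key_coeff_block_comp_perm:
  assumes "\<forall>B\<in>set Bs. sorted B" "list_all2 (\<lambda>B x. length x = length B) Bs xs"
    and "list_all2 (\<lambda>x y. mset x = mset y) xs ys" "length P' = length P"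
  shows "key_coeff (P @ concat Bs) (P' @ concat xs) = key_coeff (P @ concat Bs) (P' @ concat ys)"
  using assms(2,1,3,4)
proof (induction Bs xs arbitrary: ys P P' rule: list_all2_induct)
  case (Cons B Bs x xs)
  then obtain y ys' where ys: "ys = y # ys'" "mset x = mset y" by (auto simp: list_all2_Cons1)
  then have "length y = length B" using Cons.hyps by (metis size_mset)
  have "key_coeff (P @ B @ concat Bs) (P' @ x @ concat xs) =
      key_coeff (P @ B @ concat Bs) (P' @ y @ concat xs)"
    using Cons ys by (intro key_coeff_block_perm) auto
  also have "\<dots> = key_coeff (P @ B @ concat Bs) (P' @ y @ concat ys')"
    using Cons.IH[of ys' "P' @ y" "P @ B"] Cons.prems ys \<open>length y = length B\<close> by simp
  finally show ?case using ys by simp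
qed simp

definition common_lengths :: "nat list list \<Rightarrow> nat list list \<Rightarrow> nat list" where
  "common_lengths ps qs = map2 (\<lambda>p q. max (length p) (length q)) ps qs"

text \<open>Taken at the smallest block sizes that hold both tuples. Larger sizes give the same
  value, which for tuples of partitions turns out to be \<open>kostka_coeff\<close>.\<close>

definition stable_coeff :: "nat list list \<Rightarrow> nat list list \<Rightarrow> int" where
  "stable_coeff ps qs =
     key_coeff (block_comp ps (common_lengths ps qs)) (block_comp qs (common_lengths ps qs))"

lemma fits_common_lengths:
  assumes "length ps = length qs"
  shows "fits ps (common_lengths ps qs)" "fits qs (common_lengths ps qs)"
  using assms by (simp_all add: common_lengths_def list_all2_conv_all_nth)

text \<open>With \<open>m\<close> the larger of two corresponding lengths, both blocks of size
  \<open>n\<close> start with \<open>n - m\<close> zeros, which can be deleted simultaneously from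
  the composition and the exponents.\<close>

lemma key_coeff_block_comp_stable:
  assumes "fits ps ns" "fits qs ns"
  shows "key_coeff (block_comp ps ns) (block_comp qs ns) = stable_coeff ps qs"
proof -
  have "key_coeff (P @ block_comp ps ns) (P' @ block_comp qs ns) =
      key_coeff (P @ block_comp ps (common_lengths ps qs)) (P' @ block_comp qs (common_lengths ps qs))"
    if "length P' = length P" for P P'
    using assms that
  proof (induction ps ns arbitrary: qs P P' rule: list_all2_induct)
    case (Cons p ps n ns)
    then obtain q qs' where qs: "qs = q # qs'" "length q \<le> n" "fits qs' ns"
      by (auto simp: list_all2_Cons2)
    define m where "m = max (length p) (length q)"
    have len: "length ps = length qs'"
      using list_all2_lengthD[OF Cons.hyps(2)] list_all2_lengthD[OF qs(3)] by simp
    have split: "block r n = replicate (n - m) 0 @ block r m" if "length r \<le> m" for r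
      using that Cons.hyps(1) qs(2) by (simp add: block_def m_def flip: replicate_add append_assoc)
    have "key_coeff (P @ block p n @ block_comp ps ns) (P' @ block q n @ block_comp qs' ns) =
        key_coeff (P @ block p m @ block_comp ps ns) (P' @ block q m @ block_comp qs' ns)"
      using Cons.hyps Cons.prems qs
        key_coeff_delete_zeros[of P' P "block q m @ block_comp qs' ns" "block p m @ block_comp ps ns" "n - m"]
      by (simp add: split m_def length_block_comp)
    also have "\<dots> = key_coeff (P @ block p m @ block_comp ps (common_lengths ps qs'))
        (P' @ block q m @ block_comp qs' (common_lengths ps qs'))"
      using Cons.IH[of qs' "P' @ block q m" "P @ block p m"] Cons.prems qs by (simp add: m_def)
    finally show ?case by (simp add: qs common_lengths_def m_def)
  qed simp
  from this[of "[]" "[]"] show ?thesis by (simp add: stable_coeff_def)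
qed

lemma stable_coeff_self: "stable_coeff ps ps = 1"
  by (simp add: stable_coeff_def key_coeff_triangular)

lemma Par_tuples_fits:
  assumes "ps \<in> Par_tuples r" "qs \<in> Par_tuples r"
  shows "fits ps (common_lengths ps qs)" "fits qs (common_lengths ps qs)"
  using assms by (simp_all add: Par_tuples_def fits_common_lengths)

lemma stable_coeff_triangular:
  assumes "ps \<in> Par_tuples r" "qs \<in> Par_tuples r" "stable_coeff ps qs \<noteq> 0"
  shows "qs = ps \<or> tuple_less r qs ps"
proof -
  let ?ns = "common_lengths ps qs"
  note fits = Par_tuples_fits[OF assms(1,2)]
  have "block_comp qs ?ns = block_comp ps ?ns \<or> colex_less (block_comp qs ?ns) (block_comp ps ?ns)"
    using assms(3) fits unfolding stable_coeff_def
    by (intro key_coeff_triangular) (simp_all add: length_block_comp)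
  then show ?thesis
    using block_comp_inject[OF fits(2,1)] colex_less_block_comp[OF fits(2,1)] assms(1,2)
    by (auto simp: Par_tuples_def)
qed

lemma stable_coeff_homogeneous:
  assumes "ps \<in> Par_tuples r" "qs \<in> Par_tuples r" "stable_coeff ps qs \<noteq> 0"
  shows "sum_list (concat qs) = sum_list (concat ps)"
proof -
  let ?ns = "common_lengths ps qs"
  note fits = Par_tuples_fits[OF assms(1,2)]
  have "sum_list (block_comp qs ?ns) = sum_list (block_comp ps ?ns)"
    using assms(3) fits unfolding stable_coeff_def
    by (intro key_coeff_support) (simp_all add: length_block_comp)
  then show ?thesis
    using fits by (simp add: sum_list_block_comp list_all2_lengthD)
qed

text \<open>Homogeneity fixes the total size; since parts are positive, this bounds both the number
  and the size of the parts.\<close>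

lemma finite_stable_coeff_support:
  assumes "ps \<in> Par_tuples r"
  shows "finite {qs \<in> Par_tuples r. stable_coeff ps qs \<noteq> 0}"
proof -
  define d where "d = sum_list (concat ps)"
  let ?S = "{p. set p \<subseteq> {..d} \<and> length p \<le> d}"
  have "set qs \<subseteq> ?S" if "qs \<in> Par_tuples r" "stable_coeff ps qs \<noteq> 0" for qs
  proof
    fix p assume p: "p \<in> set qs"
    have "sum_list p \<le> sum_list (map sum_list qs)"
      using p by (intro member_le_sum_list) auto
    also have "\<dots> = d"
      using stable_coeff_homogeneous[OF assms that] by (simp add: d_def sum_list_concat)
    finally have sum: "sum_list p \<le> d" .
    have "0 \<notin> set p" using p that(1) by (auto simp: Par_tuples_def Par_def)
    then have "length p \<le> sum_list p" by (induction p) auto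
    then show "p \<in> ?S" using sum member_le_sum_list[of _ p] by fastforce
  qed
  then have "{qs \<in> Par_tuples r. stable_coeff ps qs \<noteq> 0} \<subseteq> {qs. set qs \<subseteq> ?S \<and> length qs = r}"
    by (auto simp: Par_tuples_def)
  then show ?thesis
    by (rule finite_subset) (intro finite_lists_length_eq finite_lists_length_le, simp)
qed


section \<open>Types of monomials\<close>

text \<open>The only partition \<open>p\<close> for which \<open>e\<close> occurs in
  \<open>mono_sym p\<close>.\<close>

definition exponents :: "nat monomial \<Rightarrow> nat list" where
  "exponents e = rev (sorted_list_of_multiset
     (image_mset (Poly_Mapping.lookup e) (mset_set (Poly_Mapping.keys e))))"

definition tuple_type :: "nat \<Rightarrow> (nat \<times> nat) monomial \<Rightarrow> nat list list" where
  "tuple_type r e = map (\<lambda>i. exponents (Poly_Mapping.map_key (Pair i) e)) [0..<r]"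

lemma mset_exponents:
  "mset (exponents e) = image_mset (Poly_Mapping.lookup e) (mset_set (Poly_Mapping.keys e))"
  by (simp add: exponents_def)

lemma length_exponents: "length (exponents e) = card (Poly_Mapping.keys e)"
  by (metis mset_exponents size_mset size_image_mset size_mset_set)

lemma exponents_Par: "exponents e \<in> Par"
  by (auto simp: Par_def exponents_def sorted_wrt_rev in_keys_iff)

lemma exponents_eq_iff:
  assumes "p \<in> Par"
  shows "exponents e = p \<longleftrightarrow>
    image_mset (Poly_Mapping.lookup e) (mset_set (Poly_Mapping.keys e)) = mset p"
proof
  assume "image_mset (Poly_Mapping.lookup e) (mset_set (Poly_Mapping.keys e)) = mset p"
  then have "exponents e = rev (sort p)" by (simp add: exponents_def)
  also have "sort p = rev p"
    by (rule properties_for_sort) (use assms in \<open>auto simp: Par_def sorted_wrt_rev\<close>)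
  finally show "exponents e = p" by simp
qed (auto simp: mset_exponents)

lemma mono_sym_eq: "p \<in> Par \<Longrightarrow> mono_sym p e = (if exponents e = p then 1 else 0)"
  by (simp add: mono_sym_def exponents_eq_iff)

lemma lookup_map_key_Pair [simp]:
  "Poly_Mapping.lookup (Poly_Mapping.map_key (Pair i) e) = (\<lambda>j. Poly_Mapping.lookup e (i, j))"
  by (simp add: map_key.rep_eq inj_on_def comp_def)

lemma tuple_type_Par_tuples: "tuple_type r e \<in> Par_tuples r"
  by (auto simp: tuple_type_def Par_tuples_def exponents_Par)

text \<open>Each factor is an indicator function, and the conjunction of the conditions says that
  the type of \<open>e\<close> is \<open>ps\<close>.\<close>

lemma multi_mono_sym_eq:
  assumes "ps \<in> Par_tuples r"
  shows "multi_mono_sym ps e =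
    (if Poly_Mapping.keys e \<subseteq> {..<r} \<times> UNIV \<and> tuple_type r e = ps then 1 else 0)"
proof -
  have len: "length ps = r" and Par: "\<And>i. i < r \<Longrightarrow> ps ! i \<in> Par"
    using assms by (auto simp: Par_tuples_def)
  have "(\<Prod>i<r. mono_sym (ps ! i) (Poly_Mapping.map_key (Pair i) e)) =
      (\<Prod>i<r. if exponents (Poly_Mapping.map_key (Pair i) e) = ps ! i then 1 else 0)"
    by (rule prod.cong) (simp_all add: mono_sym_eq Par)
  also have "\<dots> = (if \<forall>i<r. exponents (Poly_Mapping.map_key (Pair i) e) = ps ! i then 1 else 0)"
    by (auto intro!: prod.neutral)
  also have "(\<forall>i<r. exponents (Poly_Mapping.map_key (Pair i) e) = ps ! i) \<longleftrightarrow> tuple_type r e = ps"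
    by (auto simp: tuple_type_def list_eq_iff_nth_eq len)
  finally show ?thesis by (simp add: multi_mono_sym_def len)
qed

lemma exponents_nth: "p \<in> Par \<Longrightarrow> exponents (Poly_Mapping.nth p) = p"
proof -
  assume p: "p \<in> Par"
  have "Poly_Mapping.keys (Poly_Mapping.nth p) = {..<length p}"
  proof (rule set_eqI)
    fix j
    show "j \<in> Poly_Mapping.keys (Poly_Mapping.nth p) \<longleftrightarrow> j \<in> {..<length p}"
      using p unfolding in_keys_iff lookup_nth
      by (cases "j < length p") (auto simp: nth_default_def Par_def in_set_conv_nth)
  qed
  moreover have "image_mset (nth_default 0 p) (mset_set {..<length p}) = mset p"
  proof -
    have "map (nth_default 0 p) [0..<length p] = p"
      by (rule nth_equalityI) (simp_all add: nth_default_nth)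
    then show ?thesis by (metis lessThan_atLeast0 mset_map mset_upt)
  qed
  ultimately show ?thesis
    using p by (simp add: exponents_eq_iff)
qed

text \<open>Evaluating an expansion at such an \<open>e\<close> isolates the coefficient at
  \<open>ps\<close>, which gives uniqueness of the expansion.\<close>

lemma tuple_type_surj:
  assumes "ps \<in> Par_tuples r"
  obtains e where "Poly_Mapping.keys e \<subseteq> {..<r} \<times> UNIV" "tuple_type r e = ps"
proof -
  have len: "length ps = r" and Par: "\<And>i. i < r \<Longrightarrow> ps ! i \<in> Par"
    using assms by (auto simp: Par_tuples_def)
  define f where "f = (\<lambda>(i, j). if i < r then nth_default 0 (ps ! i) j else 0)"
  have "{v. f v \<noteq> 0} \<subseteq> Sigma {..<r} (\<lambda>i. {..<length (ps ! i)})"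
    by (auto simp: f_def nth_default_def split: if_splits)
  then have "finite {v. f v \<noteq> 0}" by (rule finite_subset) auto
  then have f: "Poly_Mapping.lookup (Abs_poly_mapping f) = f" by simp
  have "Poly_Mapping.map_key (Pair i) (Abs_poly_mapping f) = Poly_Mapping.nth (ps ! i)" if "i < r" for i
    by (rule poly_mapping_eqI) (simp add: f, simp add: f_def that)
  then have "tuple_type r (Abs_poly_mapping f) = ps"
    by (intro nth_equalityI) (auto simp: tuple_type_def exponents_nth Par len)
  moreover have "Poly_Mapping.keys (Abs_poly_mapping f) \<subseteq> {..<r} \<times> UNIV"
  proof
    fix v assume "v \<in> Poly_Mapping.keys (Abs_poly_mapping f)"
    then have "f v \<noteq> 0" by (simp add: in_keys_iff f)
    then show "v \<in> {..<r} \<times> UNIV" by (auto simp: f_def split: prod.splits if_splits)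
  qed
  ultimately show ?thesis using that by blast
qed

text \<open>Besides the nonzero exponents there are \<open>n - length (exponents e)\<close> zeros
  among the first \<open>n\<close>, matching the padding of the block.\<close>

lemma mset_row:
  assumes "Poly_Mapping.keys e \<subseteq> {..<n}"
  shows "length (exponents e) \<le> n"
    and "mset (map (Poly_Mapping.lookup e) [0..<n]) = mset (block (exponents e) n)"
proof -
  show "length (exponents e) \<le> n"
    using card_mono[OF _ assms] by (simp add: length_exponents)
  have "mset (map (Poly_Mapping.lookup e) [0..<n]) =
      image_mset (Poly_Mapping.lookup e) (mset_set (Poly_Mapping.keys e \<union> ({..<n} - Poly_Mapping.keys e)))"
    using assms by (simp add: lessThan_atLeast0 Un_absorb1)
  also have "\<dots> = mset (exponents e) +
      image_mset (Poly_Mapping.lookup e) (mset_set ({..<n} - Poly_Mapping.keys e))"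
    by (subst mset_set_Union) (auto simp: mset_exponents)
  also have "image_mset (Poly_Mapping.lookup e) (mset_set ({..<n} - Poly_Mapping.keys e)) =
      image_mset (\<lambda>_. 0) (mset_set ({..<n} - Poly_Mapping.keys e))"
    by (rule image_mset_cong) (simp add: in_keys_iff)
  also have "\<dots> = replicate_mset (n - length (exponents e)) 0"
    using assms by (simp add: image_mset_const_eq length_exponents card_Diff_subset)
  finally show "mset (map (Poly_Mapping.lookup e) [0..<n]) = mset (block (exponents e) n)"
    by (simp add: block_def)
qed


section \<open>The stable limit\<close>

text \<open>Only positions below \<open>length vs\<close> occur in \<open>f\<close>, and on them the
  renaming is injective since \<open>vs\<close> is distinct. Beyond them \<open>vs ! k\<close> is
  unspecified, hence the second hypothesis.\<close>

lemma coeff_rename_nth: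
  assumes "distinct vs" "\<And>d. d \<in> Poly_Mapping.keys f \<Longrightarrow> Poly_Mapping.keys d \<subseteq> {..<length vs}"
  shows "coeff (rename (\<lambda>k. vs ! k) f) e =
    (if Poly_Mapping.keys e \<subseteq> set vs then list_coeff f (map (Poly_Mapping.lookup e) vs) else 0)"
proof -
  let ?n = "length vs" and ?rm = "rename_monomial (\<lambda>k. vs ! k)"
  have lookup: "Poly_Mapping.lookup (?rm d) w = (\<Sum>k<?n. (Poly_Mapping.lookup d k when vs ! k = w))"
    if "Poly_Mapping.keys d \<subseteq> {..<?n}" for d w
    by (subst rename_monomial_superset[OF _ that]) (simp_all add: lookup_sum lookup_single)
  have nth: "Poly_Mapping.lookup (?rm d) (vs ! k) = Poly_Mapping.lookup d k"
    if "Poly_Mapping.keys d \<subseteq> {..<?n}" "k < ?n" for d k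
  proof -
    have "Poly_Mapping.lookup (?rm d) (vs ! k) = (\<Sum>j<?n. if j = k then Poly_Mapping.lookup d k else 0)"
      unfolding lookup[OF that(1)]
      by (rule sum.cong) (use assms(1) that(2) in \<open>auto simp: nth_eq_iff_index_eq\<close>)
    then show ?thesis using that(2) by simp
  qed
  have outside: "Poly_Mapping.lookup (?rm d) w = 0"
    if "Poly_Mapping.keys d \<subseteq> {..<?n}" "w \<notin> set vs" for d w
    unfolding lookup[OF that(1)] by (rule sum.neutral) (use that(2) in \<open>auto simp: when_def\<close>)
  show ?thesis
  proof (cases "Poly_Mapping.keys e \<subseteq> set vs")
    case True
    define d where "d = Poly_Mapping.nth (map (Poly_Mapping.lookup e) vs)"
    have d: "Poly_Mapping.keys d \<subseteq> {..<?n}"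
      by (auto simp: d_def in_keys_iff nth_default_def simp del: keys_nth split: if_splits)
    have "?rm d = e"
    proof (rule poly_mapping_eqI)
      fix w
      show "Poly_Mapping.lookup (?rm d) w = Poly_Mapping.lookup e w"
      proof (cases "w \<in> set vs")
        case True
        then obtain k where k: "k < ?n" "w = vs ! k" by (auto simp: in_set_conv_nth)
        then show ?thesis using nth[OF d k(1)] by (simp add: d_def nth_default_nth)
      next
        case False
        then show ?thesis using outside[OF d False] True by (auto simp: in_keys_iff)
      qed
    qed
    moreover have "coeff (rename (\<lambda>k. vs ! k) f) (?rm d) = coeff f d"
    proof (rule coeff_rename_eq)
      fix d' assume d': "d' \<in> Poly_Mapping.keys f" "?rm d' = ?rm d"
      show "d' = d"
      proof (rule poly_mapping_eqI)
        fix k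
        show "Poly_Mapping.lookup d' k = Poly_Mapping.lookup d k"
        proof (cases "k < ?n")
          case True
          then show ?thesis using nth[OF assms(2)[OF d'(1)]] nth[OF d] d'(2) by metis
        next
          case False
          then have "k \<notin> Poly_Mapping.keys d'" "k \<notin> Poly_Mapping.keys d"
            using assms(2)[OF d'(1)] d by blast+
          then show ?thesis by (simp add: in_keys_iff)
        qed
      qed
    qed
    ultimately show ?thesis using True by (simp add: d_def)
  next
    case False
    have "coeff (rename (\<lambda>k. vs ! k) f) e = 0"
    proof (rule coeff_rename_zero)
      fix d assume "d \<in> Poly_Mapping.keys f"
      then show "?rm d \<noteq> e" using False outside[OF assms(2)] by (auto simp: in_keys_iff)
    qed
    then show ?thesis using False by simp
  qed
qed

lemma set_block_vars: "set (block_vars ns) = {(i, j). i < length ns \<and> j < ns ! i}"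
  by (auto simp: block_vars_def)

lemma distinct_block_vars: "distinct (block_vars ns)"
proof -
  have "distinct (concat (map (\<lambda>i. map (Pair i) [0..<ns ! i]) [0..<m]))" for m
    by (induction m) (auto simp: distinct_map inj_on_def)
  then show ?thesis by (simp add: block_vars_def)
qed

lemma length_block_vars: "length (block_vars ns) = sum_list ns"
proof -
  have "length (block_vars ns) = sum_list (map (\<lambda>i. ns ! i) [0..<length ns])"
    by (simp add: block_vars_def length_concat comp_def)
  then show ?thesis by (simp add: map_nth)
qed

lemma coeff_block_key_poly_eq_key_coeff:
  assumes "fits ps ns"
  shows "coeff (block_key_poly ps ns) e =
    (if Poly_Mapping.keys e \<subseteq> set (block_vars ns)
     then key_coeff (block_comp ps ns) (map (Poly_Mapping.lookup e) (block_vars ns)) else 0)"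
  unfolding block_key_poly_def
proof (rule coeff_rename_nth[OF distinct_block_vars])
  fix d assume "d \<in> Poly_Mapping.keys (key_poly (block_comp ps ns))"
  from keys_key_poly[OF this] show "Poly_Mapping.keys d \<subseteq> {..<length (block_vars ns)}"
    by (simp add: length_block_vars length_block_comp[OF assms])
qed

text \<open>Symmetry replaces the exponents in each block by the block of their partition; stability
  then removes the dependence on \<open>ns\<close>.\<close>

lemma coeff_block_key_poly:
  assumes "ps \<in> Par_tuples r" "fits ps ns" "Poly_Mapping.keys e \<subseteq> set (block_vars ns)"
  shows "coeff (block_key_poly ps ns) e = stable_coeff ps (tuple_type r e)"
proof -
  have r: "length ps = r" "length ns = r" and Par: "\<forall>p\<in>set ps. p \<in> Par"
    using assms(1) list_all2_lengthD[OF assms(2)] by (auto simp: Par_tuples_def)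
  let ?row = "\<lambda>i. map (\<lambda>j. Poly_Mapping.lookup e (i, j)) [0..<ns ! i]"
  have row: "length (exponents (Poly_Mapping.map_key (Pair i) e)) \<le> ns ! i"
      "mset (?row i) = mset (block (exponents (Poly_Mapping.map_key (Pair i) e)) (ns ! i))"
    if "i < r" for i
  proof -
    have keys: "Poly_Mapping.keys (Poly_Mapping.map_key (Pair i) e) \<subseteq> {..<ns ! i}"
    proof
      fix j assume "j \<in> Poly_Mapping.keys (Poly_Mapping.map_key (Pair i) e)"
      then have "(i, j) \<in> Poly_Mapping.keys e" by (simp add: in_keys_iff)
      then show "j \<in> {..<ns ! i}" using assms(3) by (auto simp: set_block_vars)
    qed
    show "length (exponents (Poly_Mapping.map_key (Pair i) e)) \<le> ns ! i"
      "mset (?row i) = mset (block (exponents (Poly_Mapping.map_key (Pair i) e)) (ns ! i))"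
      using mset_row[OF keys] by simp_all
  qed
  have fits: "fits (tuple_type r e) ns"
    by (auto simp: list_all2_conv_all_nth tuple_type_def r row)
  have concat: "block_comp qs ns = concat (map2 block qs ns)" for qs
    by (simp add: block_comp_def block_def)
  have "coeff (block_key_poly ps ns) e =
      key_coeff (block_comp ps ns) (map (Poly_Mapping.lookup e) (block_vars ns))"
    using coeff_block_key_poly_eq_key_coeff[OF assms(2)] assms(3) by simp
  also have "map (Poly_Mapping.lookup e) (block_vars ns) = concat (map ?row [0..<r])"
    by (simp add: block_vars_def map_concat comp_def r)
  also have "key_coeff (block_comp ps ns) \<dots> = key_coeff (block_comp ps ns) (block_comp (tuple_type r e) ns)"
    unfolding concat
  proof (rule key_coeff_block_comp_perm[of _ _ _ "[]" "[]", simplified])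
    show "\<forall>B\<in>set (map2 block ps ns). sorted B"
      using Par sorted_block by (auto simp: set_zip)
    show "list_all2 (\<lambda>B x. length x = length B) (map2 block ps ns) (map ?row [0..<r])"
      using assms(2) by (auto simp: list_all2_conv_all_nth r)
    show "list_all2 (\<lambda>x y. mset x = mset y) (map ?row [0..<r]) (map2 block (tuple_type r e) ns)"
      by (simp add: list_all2_conv_all_nth r tuple_type_def row(2) del: mset_map)
  qed
  also have "\<dots> = stable_coeff ps (tuple_type r e)"
    by (rule key_coeff_block_comp_stable[OF assms(2) fits])
  finally show ?thesis .
qed

lemma stable_key_eq:
  assumes "ps \<in> Par_tuples r"
  shows "stable_key ps e =
    (if Poly_Mapping.keys e \<subseteq> {..<r} \<times> UNIV then stable_coeff ps (tuple_type r e) else 0)"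
    (is "_ = ?c")
proof -
  have r: "length ps = r" using assms by (simp add: Par_tuples_def)
  \<comment> \<open>From this size on, every partition fits into its block and every variable of
    \<open>e\<close> with first index below \<open>r\<close> is available. For \<open>e = 0\<close>
    the value of \<open>Max\<close> is unspecified but harmless.\<close>
  define N where "N = Suc (sum_list (map length ps) + Max (snd ` Poly_Mapping.keys e))"
  have N: "coeff (block_key_poly ps ns) e = ?c" if ns: "length ns = r" "\<forall>n\<in>set ns. N \<le> n" for ns
  proof -
    have ge: "N \<le> ns ! i" if "i < r" for i using ns that by simp
    have "length (ps ! i) \<le> N" if "i < r" for i
      using member_le_sum_list[of "length (ps ! i)" "map length ps"] that r by (simp add: N_def)
    then have fits: "fits ps ns"
      using ge r ns(1) by (fastforce simp: list_all2_conv_all_nth)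
    show ?thesis
    proof (cases "Poly_Mapping.keys e \<subseteq> {..<r} \<times> UNIV")
      case True
      have "Poly_Mapping.keys e \<subseteq> set (block_vars ns)"
      proof
        fix v assume v: "v \<in> Poly_Mapping.keys e"
        then have "snd v \<le> Max (snd ` Poly_Mapping.keys e)" by (intro Max_ge) auto
        then have "snd v < N" by (simp add: N_def)
        moreover have "fst v < r" using True v by auto
        ultimately show "v \<in> set (block_vars ns)"
          using ge[of "fst v"] ns(1) by (auto simp: set_block_vars)
      qed
      then show ?thesis using True coeff_block_key_poly[OF assms fits] by simp
    next
      case False
      then have "\<not> Poly_Mapping.keys e \<subseteq> set (block_vars ns)"
        using ns(1) by (auto simp: set_block_vars)
      then show ?thesis using False coeff_block_key_poly_eq_key_coeff[OF fits] by simp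
    qed
  qed
  show ?thesis unfolding stable_key_def
  proof (rule the_equality)
    show "\<exists>N. \<forall>ns. length ns = length ps \<and> (\<forall>n\<in>set ns. N \<le> n) \<longrightarrow> coeff (block_key_poly ps ns) e = ?c"
      using N r by blast
  next
    fix c
    assume "\<exists>N. \<forall>ns. length ns = length ps \<and> (\<forall>n\<in>set ns. N \<le> n) \<longrightarrow> coeff (block_key_poly ps ns) e = c"
    then obtain M where "\<And>ns. length ns = r \<Longrightarrow> \<forall>n\<in>set ns. M \<le> n \<Longrightarrow> coeff (block_key_poly ps ns) e = c"
      using r by blast
    \<comment> \<open>Block sizes beyond both thresholds show that the two limits agree.\<close>
    from this[of "replicate r (M + N)"] N[of "replicate r (M + N)"] show "c = ?c" by simp
  qed
qed

lemma kostka_coeff_eq: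
  assumes "ps \<in> Par_tuples r"
  shows "kostka_coeff ps = (\<lambda>qs. if qs \<in> Par_tuples r then stable_coeff ps qs else 0)"
    (is "_ = ?c")
proof -
  have r: "length ps = r" using assms by (simp add: Par_tuples_def)
  \<comment> \<open>Only the type of \<open>e\<close> contributes, so a finite expansion evaluates
    to a single coefficient. Applied to an arbitrary candidate \<open>c\<close>, this yields
    uniqueness.\<close>
  have eval: "(\<Sum>qs | c qs \<noteq> 0. c qs * multi_mono_sym qs e) =
      (if Poly_Mapping.keys e \<subseteq> {..<r} \<times> UNIV then c (tuple_type r e) else 0)"
    if "finite {qs. c qs \<noteq> 0}" "{qs. c qs \<noteq> 0} \<subseteq> Par_tuples r" for c and e :: "(nat \<times> nat) monomial"
  proof -
    have "(\<Sum>qs | c qs \<noteq> 0. c qs * multi_mono_sym qs e) =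
        (\<Sum>qs | c qs \<noteq> 0. if qs = tuple_type r e
           then if Poly_Mapping.keys e \<subseteq> {..<r} \<times> UNIV then c (tuple_type r e) else 0 else 0)"
      by (rule sum.cong) (use that(2) in \<open>auto simp: multi_mono_sym_eq[of _ r] tuple_type_Par_tuples\<close>)
    then show ?thesis using that(1) by simp
  qed
  have "{qs. ?c qs \<noteq> 0} = {qs \<in> Par_tuples r. stable_coeff ps qs \<noteq> 0}" by auto
  then have c: "finite {qs. ?c qs \<noteq> 0}" "{qs. ?c qs \<noteq> 0} \<subseteq> Par_tuples r"
    using finite_stable_coeff_support[OF assms] by auto
  show ?thesis unfolding kostka_coeff_def mono_expansion_def r
  proof (rule the_equality, intro conjI)
    show "stable_key ps = (\<lambda>e. \<Sum>qs | ?c qs \<noteq> 0. ?c qs * multi_mono_sym qs e)"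
      unfolding eval[OF c] using stable_key_eq[OF assms] tuple_type_Par_tuples by (auto simp: fun_eq_iff)
  next
    fix c
    assume *: "finite {qs. c qs \<noteq> 0} \<and> {qs. c qs \<noteq> 0} \<subseteq> Par_tuples r \<and>
      stable_key ps = (\<lambda>e. \<Sum>qs | c qs \<noteq> 0. c qs * multi_mono_sym qs e)"
    show "c = ?c"
    proof
      fix qs
      show "c qs = ?c qs"
      proof (cases "qs \<in> Par_tuples r")
        case True
        then obtain e where "Poly_Mapping.keys e \<subseteq> {..<r} \<times> UNIV" "tuple_type r e = qs"
          by (rule tuple_type_surj)
        moreover from * have "stable_key ps e = (\<Sum>qs | c qs \<noteq> 0. c qs * multi_mono_sym qs e)"
          by metis
        ultimately show ?thesis
          using True * stable_key_eq[OF assms, of e] eval[of c e] by simp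
      qed (use * in auto)
    qed
  qed (use c in auto)
qed


section \<open>The unitriangular expansion\<close>

theorem mainTheorem8:
  fixes r :: nat and las :: "nat list list"
  assumes "r \<ge> 1" and "las \<in> Par_tuples r"
  shows "stable_key las =
    (\<lambda>e. multi_mono_sym las e +
      (\<Sum>\<mu>s | \<mu>s \<in> Par_tuples r \<and> tuple_less r \<mu>s las \<and> kostka_coeff las \<mu>s \<noteq> 0.
         kostka_coeff las \<mu>s * multi_mono_sym \<mu>s e))"
proof
  fix e
  define S where "S = {\<mu>s. \<mu>s \<in> Par_tuples r \<and> tuple_less r \<mu>s las \<and> kostka_coeff las \<mu>s \<noteq> 0}"
  have kostka: "kostka_coeff las \<mu>s = stable_coeff las \<mu>s" if "\<mu>s \<in> Par_tuples r" for \<mu>s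
    using kostka_coeff_eq[OF assms(2)] that by simp
  have "finite S"
    by (rule finite_subset[OF _ finite_stable_coeff_support[OF assms(2)]]) (auto simp: S_def kostka)
  define \<mu>s where "\<mu>s = tuple_type r e"
  have \<mu>s: "\<mu>s \<in> Par_tuples r" by (simp add: \<mu>s_def tuple_type_Par_tuples)
  let ?in = "Poly_Mapping.keys e \<subseteq> {..<r} \<times> UNIV"
  have "(\<Sum>\<nu>s\<in>S. kostka_coeff las \<nu>s * multi_mono_sym \<nu>s e) =
      (\<Sum>\<nu>s\<in>S. if \<nu>s = \<mu>s then if ?in then stable_coeff las \<mu>s else 0 else 0)"
    by (rule sum.cong) (auto simp: S_def kostka multi_mono_sym_eq[of _ r] \<mu>s_def)
  also have "\<dots> = (if \<mu>s \<in> S \<and> ?in then stable_coeff las \<mu>s else 0)"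
    using \<open>finite S\<close> by simp
  \<comment> \<open>\<open>las\<close> is not in \<open>S\<close> by irreflexivity, so the leading
    term and the sum never both contribute.\<close>
  finally have "multi_mono_sym las e + (\<Sum>\<nu>s\<in>S. kostka_coeff las \<nu>s * multi_mono_sym \<nu>s e) =
      (if ?in then if \<mu>s = las then 1 else if \<mu>s \<in> S then stable_coeff las \<mu>s else 0 else 0)"
    using tuple_less_irrefl by (auto simp: multi_mono_sym_eq[OF assms(2)] \<mu>s_def S_def)
  \<comment> \<open>By triangularity the coefficient vanishes if \<open>\<mu>s\<close> is neither
    \<open>las\<close> nor in \<open>S\<close>, and at \<open>las\<close> it is 1.\<close>
  also have "\<dots> = (if ?in then stable_coeff las \<mu>s else 0)"
    using \<mu>s kostka[OF \<mu>s] stable_coeff_self[of las] stable_coeff_triangular[OF assms(2) \<mu>s]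
    by (auto simp: S_def)
  also have "\<dots> = stable_key las e"
    using stable_key_eq[OF assms(2)] by (simp add: \<mu>s_def)
  finally show "stable_key las e = multi_mono_sym las e +
      (\<Sum>\<mu>s | \<mu>s \<in> Par_tuples r \<and> tuple_less r \<mu>s las \<and> kostka_coeff las \<mu>s \<noteq> 0.
         kostka_coeff las \<mu>s * multi_mono_sym \<mu>s e)"
    by (simp add: S_def)
qed

end
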